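(* Let $\varepsilon\in(0,1)$, and let $q=q(n)$ be a positive integer depending on $n$. Consider, for each $n$, the rate-$1$ continuous-time Diaconis–Gangolli random walk on $n\times n$ contingency tables over $\mathbb{Z}_q$ (with any fixed row and column sums), and let $d(t)$, $t_{\mathrm{mix}}(\varepsilon)$ be as in the context. (a) Let $$\alpha:=\inf\Big\{z\ge1:\ 4\varepsilon^2\ge\exp\Big(\tfrac{6+12e^{4/e}+12e^{8/e}+6e^{32/e}}{z^{1/4}}\Big)-1\Big\}.$$ If $q/n^2\to\infty$ as $n\to\infty$, then for $t=t_n=\dfrac{n^2q^2\log(\sqrt{\alpha}\,(n-1))}{8\pi^2}\Big(1-\dfrac{4}{3q}\Big)^{-1}$ we have $d(t_n)\le\varepsilon+o(1)$ as $n\to\infty$. (b) If $q\to\infty$ and $q/\sqrt{\log n}\to\infty$ as $n\to\infty$, then for all sufficiently large $n$, $$t_{\mathrm{mix}}(\varepsilon)\ \ge\ \frac{n^2q^2}{8\pi^2}\Big(\log n+\log\Big(1-\frac1n\Big)+\frac12\log\Big(\frac{\varepsilon^{-1}-1}{5}\Big)\Big).$$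
   Context: $\mathbb{Z}_q=\mathbb{Z}/q\mathbb{Z}$. An $n\times n$ contingency table over $\mathbb{Z}_q$ is an $n\times n$ matrix with entries in $\mathbb{Z}_q$ with prescribed row sums $(r_1,\dots,r_n)\in\mathbb{Z}_q^n$ and column sums $(c_1,\dots,c_n)\in\mathbb{Z}_q^n$; $\Omega$ denotes the set of such tables. The rate-$1$ continuous-time Diaconis–Gangolli walk jumps at the times of a rate-$1$ Poisson process; at each jump, two rows $i<i'$ and two columns $j<j'$ are chosen independently and uniformly at random, a fair coin is flipped, and the matrix $T$ with entries $+1$ at $(i,j)$ and $(i',j')$, $-1$ at $(i,j')$ and $(i',j)$, and $0$ elsewhere is added (heads) or subtracted (tails). Let $H_t(x,\cdot)$ be the law at time $t$ from $x$, $\pi$ the uniform distribution on $\Omega$, $d(t)=\max_{x\in\Omega}\|H_t(x,\cdot)-\pi\|_{TV}$ (total variation distance $\|\mu-\nu\|_{TV}=\max_A|\mu(A)-\nu(A)|$), and $t_{\mathrm{mix}}(\varepsilon)=\inf\{t\ge0:d(t)\le\varepsilon\}$. *)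

theory Defs
  imports "HOL-Analysis.Analysis"
begin

text \<open>Tables: functions nat => nat => int; entries for a,b < n are
representatives in {0..<q} of Z_q, all other entries are 0.
Row sums r and column sums c are given as integers, read modulo q.\<close>

definition tables :: "nat \<Rightarrow> nat \<Rightarrow> (nat \<Rightarrow> int) \<Rightarrow> (nat \<Rightarrow> int) \<Rightarrow> (nat \<Rightarrow> nat \<Rightarrow> int) set" where
  "tables n q r c = {x.
     (\<forall>a b. (a < n \<and> b < n \<longrightarrow> 0 \<le> x a b \<and> x a b < int q) \<and>
            (\<not>(a < n \<and> b < n) \<longrightarrow> x a b = 0)) \<and>
     (\<forall>a<n. (\<Sum>b<n. x a b) mod int q = r a mod int q) \<and>
     (\<forall>b<n. (\<Sum>a<n. x a b) mod int q = c b mod int q)}"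

definition move_T :: "nat \<Rightarrow> nat \<Rightarrow> nat \<Rightarrow> nat \<Rightarrow> nat \<Rightarrow> nat \<Rightarrow> int" where
  "move_T i i' j j' a b =
     (if (a = i \<and> b = j) \<or> (a = i' \<and> b = j') then 1
      else if (a = i \<and> b = j') \<or> (a = i' \<and> b = j) then -1 else 0)"

definition apply_move :: "nat \<Rightarrow> nat \<Rightarrow> (nat \<Rightarrow> nat \<Rightarrow> int) \<Rightarrow> nat \<Rightarrow> nat \<Rightarrow> nat \<Rightarrow> nat \<Rightarrow> int
    \<Rightarrow> (nat \<Rightarrow> nat \<Rightarrow> int)" where
  "apply_move n q x i i' j j' s =
     (\<lambda>a b. if a < n \<and> b < n then (x a b + s * move_T i i' j j' a b) mod int q else 0)"

definition ordered_pairs :: "nat \<Rightarrow> (nat \<times> nat) set" where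
  "ordered_pairs n = {(i, i'). i < i' \<and> i' < n}"

definition dg_P :: "nat \<Rightarrow> nat \<Rightarrow> (nat \<Rightarrow> nat \<Rightarrow> int) \<Rightarrow> (nat \<Rightarrow> nat \<Rightarrow> int) \<Rightarrow> real" where
  "dg_P n q x y =
     (\<Sum>(i, i')\<in>ordered_pairs n. \<Sum>(j, j')\<in>ordered_pairs n. \<Sum>s\<in>{1, -1::int}.
        (if apply_move n q x i i' j j' s = y then 1 else 0))
     / (2 * real (card (ordered_pairs n)) ^ 2)"

fun dg_Pk :: "nat \<Rightarrow> nat \<Rightarrow> (nat \<Rightarrow> int) \<Rightarrow> (nat \<Rightarrow> int) \<Rightarrow> nat
    \<Rightarrow> (nat \<Rightarrow> nat \<Rightarrow> int) \<Rightarrow> (nat \<Rightarrow> nat \<Rightarrow> int) \<Rightarrow> real" where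
  "dg_Pk n q r c 0 x y = (if x = y then 1 else 0)"
| "dg_Pk n q r c (Suc k) x y = (\<Sum>z\<in>tables n q r c. dg_Pk n q r c k x z * dg_P n q z y)"

definition dg_H :: "nat \<Rightarrow> nat \<Rightarrow> (nat \<Rightarrow> int) \<Rightarrow> (nat \<Rightarrow> int) \<Rightarrow> real
    \<Rightarrow> (nat \<Rightarrow> nat \<Rightarrow> int) \<Rightarrow> (nat \<Rightarrow> nat \<Rightarrow> int) \<Rightarrow> real" where
  "dg_H n q r c t x y = (\<Sum>k. exp (- t) * t ^ k / fact k * dg_Pk n q r c k x y)"

definition dg_tv :: "nat \<Rightarrow> nat \<Rightarrow> (nat \<Rightarrow> int) \<Rightarrow> (nat \<Rightarrow> int) \<Rightarrow> real
    \<Rightarrow> (nat \<Rightarrow> nat \<Rightarrow> int) \<Rightarrow> real" where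
  "dg_tv n q r c t x =
     Max {\<bar>(\<Sum>y\<in>A. dg_H n q r c t x y) - real (card A) / real (card (tables n q r c))\<bar>
          | A. A \<subseteq> tables n q r c}"

definition dg_d :: "nat \<Rightarrow> nat \<Rightarrow> (nat \<Rightarrow> int) \<Rightarrow> (nat \<Rightarrow> int) \<Rightarrow> real \<Rightarrow> real" where
  "dg_d n q r c t = Max ((\<lambda>x. dg_tv n q r c t x) ` tables n q r c)"

definition dg_tmix :: "nat \<Rightarrow> nat \<Rightarrow> (nat \<Rightarrow> int) \<Rightarrow> (nat \<Rightarrow> int) \<Rightarrow> real \<Rightarrow> real" where
  "dg_tmix n q r c \<epsilon> = Inf {t. t \<ge> 0 \<and> dg_d n q r c t \<le> \<epsilon>}"

definition alpha_const :: "real \<Rightarrow> real" where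
  "alpha_const \<epsilon> = Inf {z. z \<ge> 1 \<and>
     4 * \<epsilon>^2 \<ge> exp ((6 + 12 * exp (4 / exp 1) + 12 * exp (8 / exp 1) + 6 * exp (32 / exp 1))
                      / z powr (1/4)) - 1}"

end

theory Submission
  imports Defs "HOL-Real_Asymp.Real_Asymp"
begin

text \<open>The walk is a symmetric random walk on a coset of the group of tables with zero margins, so it is
  diagonalised by the characters \<open>x \<mapsto> exp (2 \<pi> i \<langle>\<xi>, x\<rangle> / q)\<close>, where the matrix \<open>\<xi>\<close> matters only
  modulo row-constant and column-constant matrices.  Its spectral gap at \<open>\<xi>\<close> is the average of
  \<open>1 - cos (2 \<pi> D / q)\<close> over all \<open>2 \<times> 2\<close> mixed differences \<open>D\<close> of \<open>\<xi>\<close>.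

  (a) The \<open>L\<^sup>2\<close> bound reduces the claim to the sum of \<open>exp (- 2 t gap \<xi>)\<close> over nonzero \<open>\<xi>\<close>.  The exponent
  is the mean pairwise energy of the rows of \<open>\<xi>\<close>, and the energy of a difference of two rows is again a mean
  pairwise energy, of its entries.  One estimate for partition functions of mean pairwise
  energies, applied first to rows of entries and then to matrices of rows, shows that the sum is dominated
  by matrices with few nonzero entries and is at most \<open>2352 / \<alpha> + o(1)\<close>.

  (b) The sum over all cells of the single-cell characters, centred at the starting table, is an
  eigenfunction with stationary mean zero.  Its variance exceeds \<open>n\<^sup>2\<close> by at most a vanishing multiple of
  its squared mean; a second-moment comparison bounds the total variation distance from below at every time
  before the claimed one.\<close>

section \<open>Spectral decomposition of the walk\<close>

text \<open>Put N = sqrt \<alpha> (n - 1). The time in (a) is chosen so that the matrix with a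
  single entry 1 contributes at most N^(-2): its gap is 4/n^2 times \<open>osc q 1\<close>, which is
  at least 2 pi^2 / q^2 times the correction 1 - 4/(3q). With about n^2 places for the entry, this
  gives order n^2 / N^2, that is 1 / \<alpha>. The obstacle is that m nonzero coordinates do not act
  independently: pairs inside the support may cost nothing, so only a fraction 1 - m/n of the energy
  is guaranteed. The loss N^(2m/n) per coordinate is absorbed by the 1/m in the bound (3n/m)^m for
  the binomial coefficient as long as N^(2m/n) <= 2m, which holds up to m = n/4 for large n. For
  larger supports the 2^n choices are beaten by a small weight raised to a power of order n, so half
  of the energy is enough. In (b), the point is that the gap of a difference of two cells falls
  short of the sum of their gaps by at most a relative 1 / (n - 1)^2.\<close>

definition phase :: "nat \<Rightarrow> nat \<Rightarrow> (nat \<Rightarrow> nat \<Rightarrow> int) \<Rightarrow> (nat \<Rightarrow> nat \<Rightarrow> int) \<Rightarrow> real" where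
  "phase n q \<xi> x = 2 * pi * real_of_int (\<Sum>a<n. \<Sum>b<n. \<xi> a b * x a b) / real q"

text \<open>This is the pairing of \<open>\<xi>\<close> with the matrix of a move, hence the amount,
  up to sign and the factor 2 pi / q, by which the move shifts the phase.\<close>

definition minor :: "(nat \<Rightarrow> nat \<Rightarrow> int) \<Rightarrow> nat \<Rightarrow> nat \<Rightarrow> nat \<Rightarrow> nat \<Rightarrow> int" where
  "minor \<xi> i i' j j' = \<xi> i j - \<xi> i j' - \<xi> i' j + \<xi> i' j'"

definition osc :: "nat \<Rightarrow> int \<Rightarrow> real" where
  "osc q k = 1 - cos (2 * pi * real_of_int k / real q)"

definition gap :: "nat \<Rightarrow> nat \<Rightarrow> (nat \<Rightarrow> nat \<Rightarrow> int) \<Rightarrow> real" where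
  "gap n q \<xi> = (\<Sum>i<n. \<Sum>i'<n. \<Sum>j<n. \<Sum>j'<n. osc q (minor \<xi> i i' j j'))
      / (real n ^ 2 * (real n - 1) ^ 2)"

lemma osc_nonneg: "0 \<le> osc q k"
  by (simp add: osc_def)

lemma osc_0 [simp]: "osc q 0 = 0"
  by (simp add: osc_def)

lemma osc_minus [simp]: "osc q (- k) = osc q k"
  by (simp add: osc_def)

lemma gap_nonneg: "0 \<le> gap n q \<xi>"
  unfolding gap_def by (intro divide_nonneg_nonneg sum_nonneg osc_nonneg) auto

lemma cos_cong_mod:
  assumes "q > 0" "int q dvd k - l"
  shows "cos (2 * pi * real_of_int k / real q + \<phi>) = cos (2 * pi * real_of_int l / real q + \<phi>)"
proof -
  obtain m where m: "k = l + int q * m"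
    using assms(2) by (metis dvd_def add.commute diff_eq_eq)
  have "2 * pi * real_of_int k / real q + \<phi> = (2 * pi * real_of_int l / real q + \<phi>) + 2 * pi * real_of_int m"
    using assms(1) by (simp add: m field_simps)
  then show ?thesis
    by (simp only: cos_add[of _ "2 * pi * real_of_int m"] cos_int_2pin sin_int_2pin mult_1_right mult_zero_right diff_zero)
qed

lemma osc_cong_mod:
  assumes "q > 0" "int q dvd k - l"
  shows "osc q k = osc q l"
  using cos_cong_mod[OF assms, of 0] by (simp add: osc_def)

text \<open>A move is a rank-one matrix, a difference of two row indicators times a difference of
  two column indicators. The vanishing margins and the pairing with \<open>\<xi>\<close> both follow
  from this factorisation.\<close>

lemma move_T_eq:
  assumes "i \<noteq> i'" "j \<noteq> j'"
  shows "move_T i i' j j' a b =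
    (of_bool (a = i) - of_bool (a = i')) * (of_bool (b = j) - of_bool (b = j'))"
  using assms by (auto simp: move_T_def)

lemma sum_mult_bool_diff:
  fixes j j' n :: nat
  assumes "j < n" "j' < n"
  shows "(\<Sum>b<n. f b * (of_bool (b = j) - of_bool (b = j'))) = f j - (f j' :: int)"
proof -
  have "(\<Sum>b<n. f b * (of_bool (b = j) - of_bool (b = j')))
      = (\<Sum>b<n. if b = j then f b else 0) - (\<Sum>b<n. if b = j' then f b else 0)"
    by (subst sum_subtractf[symmetric], intro sum.cong) (auto simp: algebra_simps)
  also have "\<dots> = f j - f j'"
    using assms by simp
  finally show ?thesis .
qed

lemma sum_move_T:
  assumes "i \<noteq> i'" "j \<noteq> j'" "i < n" "i' < n" "j < n" "j' < n"
  shows "(\<Sum>a<n. \<Sum>b<n. \<xi> a b * move_T i i' j j' a b) = minor \<xi> i i' j j'"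
proof -
  have "(\<Sum>a<n. \<Sum>b<n. \<xi> a b * move_T i i' j j' a b)
     = (\<Sum>a<n. (\<Sum>b<n. \<xi> a b * (of_bool (b = j) - of_bool (b = j'))) * (of_bool (a = i) - of_bool (a = i')))"
    by (intro sum.cong refl, subst sum_distrib_right) (simp add: move_T_eq[OF assms(1,2)] mult_ac)
  also have "\<dots> = minor \<xi> i i' j j'"
    using assms by (simp add: sum_mult_bool_diff minor_def)
  finally show ?thesis .
qed

lemma pairing_apply_move:
  assumes "i \<noteq> i'" "j \<noteq> j'" "i < n" "i' < n" "j < n" "j' < n"
  shows "int q dvd (\<Sum>a<n. \<Sum>b<n. \<xi> a b * apply_move n q x i i' j j' s a b)
     - ((\<Sum>a<n. \<Sum>b<n. \<xi> a b * x a b) + s * minor \<xi> i i' j j')"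
proof -
  have "(\<Sum>a<n. \<Sum>b<n. \<xi> a b * apply_move n q x i i' j j' s a b)
     - ((\<Sum>a<n. \<Sum>b<n. \<xi> a b * x a b) + s * minor \<xi> i i' j j')
     = (\<Sum>a<n. \<Sum>b<n. \<xi> a b * (((x a b + s * move_T i i' j j' a b) mod int q) - (x a b + s * move_T i i' j j' a b)))"
    by (simp add: apply_move_def sum_move_T[OF assms, symmetric] sum_distrib_left sum.distrib
        sum_subtractf algebra_simps)
  also have "int q dvd \<dots>"
    by (intro dvd_sum dvd_mult) (metis mod_eq_dvd_iff mod_mod_trivial)
  finally show ?thesis .
qed

lemma cos_phase_apply_move:
  assumes "q > 0" "i < i'" "j < j'" "i' < n" "j' < n"
  shows "cos (phase n q \<xi> (apply_move n q x i i' j j' s) - \<phi>) =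
    cos (phase n q \<xi> x - \<phi> + 2 * pi * real_of_int (s * minor \<xi> i i' j j') / real q)"
proof -
  have "int q dvd (\<Sum>a<n. \<Sum>b<n. \<xi> a b * apply_move n q x i i' j j' s a b)
     - ((\<Sum>a<n. \<Sum>b<n. \<xi> a b * x a b) + s * minor \<xi> i i' j j')"
    by (rule pairing_apply_move) (use assms in auto)
  from cos_cong_mod[OF assms(1) this, of "- \<phi>"] show ?thesis
    by (simp add: phase_def algebra_simps add_divide_distrib)
qed

lemma sum_move_T_row:
  assumes "i \<noteq> i'" "j \<noteq> j'" "j < n" "j' < n"
  shows "(\<Sum>b<n. move_T i i' j j' a b) = 0"
  using sum_mult_bool_diff[OF assms(3,4), of "\<lambda>_. of_bool (a = i) - of_bool (a = i')"]
  by (simp add: move_T_eq[OF assms(1,2)])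

lemma sum_move_T_col:
  assumes "i \<noteq> i'" "j \<noteq> j'" "i < n" "i' < n"
  shows "(\<Sum>a<n. move_T i i' j j' a b) = 0"
  using sum_mult_bool_diff[OF assms(3,4), of "\<lambda>_. of_bool (b = j) - of_bool (b = j')"]
  by (simp add: move_T_eq[OF assms(1,2)] mult.commute)

lemma apply_move_in_tables:
  assumes "x \<in> tables n q r c" "q > 0" "i < i'" "j < j'" "i' < n" "j' < n"
  shows "apply_move n q x i i' j j' s \<in> tables n q r c"
proof -
  have row: "(\<Sum>b<n. apply_move n q x i i' j j' s a b) mod int q = (\<Sum>b<n. x a b) mod int q"
    if "a < n" for a
  proof -
    have "(\<Sum>b<n. apply_move n q x i i' j j' s a b) mod int q
        = (\<Sum>b<n. x a b + s * move_T i i' j j' a b) mod int q"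
      using that by (simp add: apply_move_def mod_sum_eq)
    also have "(\<Sum>b<n. x a b + s * move_T i i' j j' a b) = (\<Sum>b<n. x a b)"
      using assms by (simp add: sum.distrib sum_distrib_left[symmetric] sum_move_T_row)
    finally show ?thesis .
  qed
  have col: "(\<Sum>a<n. apply_move n q x i i' j j' s a b) mod int q = (\<Sum>a<n. x a b) mod int q"
    if "b < n" for b
  proof -
    have "(\<Sum>a<n. apply_move n q x i i' j j' s a b) mod int q
        = (\<Sum>a<n. x a b + s * move_T i i' j j' a b) mod int q"
      using that by (simp add: apply_move_def mod_sum_eq)
    also have "(\<Sum>a<n. x a b + s * move_T i i' j j' a b) = (\<Sum>a<n. x a b)"
      using assms by (simp add: sum.distrib sum_distrib_left[symmetric] sum_move_T_col)
    finally show ?thesis .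
  qed
  show ?thesis
    using assms(1,2) row col by (auto simp: tables_def apply_move_def)
qed

lemma finite_tables: "finite (tables n q r c)"
proof -
  have "finite (Pi\<^sub>E {..<n} (\<lambda>_. Pi\<^sub>E {..<n} (\<lambda>_. {0..<int q})))"
    by (intro finite_PiE) auto
  moreover have "inj_on (\<lambda>x. \<lambda>a\<in>{..<n}. \<lambda>b\<in>{..<n}. x a b) (tables n q r c)"
  proof (rule inj_onI, intro ext)
    fix x y :: "nat \<Rightarrow> nat \<Rightarrow> int" and a b
    assume x: "x \<in> tables n q r c" and y: "y \<in> tables n q r c"
      and eq: "(\<lambda>a\<in>{..<n}. \<lambda>b\<in>{..<n}. x a b) = (\<lambda>a\<in>{..<n}. \<lambda>b\<in>{..<n}. y a b)"
    show "x a b = y a b"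
    proof (cases "a < n \<and> b < n")
      case True
      then show ?thesis
        using fun_cong[OF fun_cong[OF eq, of a], of b] by simp
    next
      case False
      then show ?thesis using x y unfolding tables_def by (metis (mono_tags, lifting) mem_Collect_eq)
    qed
  qed
  moreover have "(\<lambda>x. \<lambda>a\<in>{..<n}. \<lambda>b\<in>{..<n}. x a b) ` tables n q r c
      \<subseteq> Pi\<^sub>E {..<n} (\<lambda>_. Pi\<^sub>E {..<n} (\<lambda>_. {0..<int q}))"
    by (auto simp: tables_def PiE_def extensional_def)
  ultimately show ?thesis
    by (meson finite_subset inj_on_finite)
qed

lemma finite_ordered_pairs: "finite (ordered_pairs n)"
  by (rule finite_subset[of _ "{..<n} \<times> {..<n}"]) (auto simp: ordered_pairs_def)

lemma sum_ordered_pairs: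
  fixes f :: "nat \<Rightarrow> nat \<Rightarrow> real"
  assumes "\<And>i. f i i = 0" "\<And>i j. f i j = f j i"
  shows "(\<Sum>i<n. \<Sum>j<n. f i j) = 2 * (\<Sum>(i, j)\<in>ordered_pairs n. f i j)"
proof -
  let ?L = "{(i, j). j < i \<and> i < n}" and ?D = "{(i, j). i = j \<and> i < n}"
  have fin: "finite ?L" "finite ?D" "finite (ordered_pairs n)"
    by (auto intro: finite_subset[of _ "{..<n} \<times> {..<n}"] finite_ordered_pairs)
  have "(\<Sum>i<n. \<Sum>j<n. f i j) = (\<Sum>(i, j)\<in>{..<n} \<times> {..<n}. f i j)"
    by (rule sum.cartesian_product)
  also have "{..<n} \<times> {..<n} = ordered_pairs n \<union> (?L \<union> ?D)"
    by (auto simp: ordered_pairs_def)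
  also have "(\<Sum>(i, j)\<in>\<dots>. f i j) = (\<Sum>(i, j)\<in>ordered_pairs n. f i j) + ((\<Sum>(i, j)\<in>?L. f i j) + (\<Sum>(i, j)\<in>?D. f i j))"
    using fin by (subst sum.union_disjoint, auto simp: ordered_pairs_def)+
  also have "(\<Sum>(i, j)\<in>?D. f i j) = 0"
    by (rule sum.neutral) (auto simp: assms)
  also have "(\<Sum>(i, j)\<in>?L. f i j) = (\<Sum>(i, j)\<in>ordered_pairs n. f i j)"
    by (rule sum.reindex_bij_witness[of _ "\<lambda>(i, j). (j, i)" "\<lambda>(i, j). (j, i)"])
       (auto simp: ordered_pairs_def assms(2))
  finally show ?thesis by simp
qed

lemma card_ordered_pairs: "2 * real (card (ordered_pairs n)) = real n * (real n - 1)"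
proof -
  have "(\<Sum>i<n. \<Sum>j<n. if i = j then 0 else 1 :: real) = 2 * (\<Sum>(i, j)\<in>ordered_pairs n. if i = j then 0 else 1)"
    by (rule sum_ordered_pairs) auto
  moreover have "(\<Sum>(i, j)\<in>ordered_pairs n. if i = j then 0 else 1 :: real) = (\<Sum>(i, j)\<in>ordered_pairs n. 1)"
    by (rule sum.cong) (auto simp: ordered_pairs_def)
  moreover have "(\<Sum>j<n. if i = j then 0 else 1 :: real) = real n - 1" if "i < n" for i
  proof -
    have "(\<Sum>j<n. if i = j then 0 else 1 :: real) = (\<Sum>j<n. 1 - (if i = j then 1 else 0))"
      by (rule sum.cong) auto
    also have "\<dots> = real n - 1"
      using that by (simp add: sum_subtractf)
    finally show ?thesis .
  qed
  ultimately show ?thesis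
    by (simp add: case_prod_beta)
qed

section \<open>Characters as eigenfunctions of the discrete walk\<close>

lemma gap_eq_ordered:
  assumes "n \<ge> 2"
  shows "1 - gap n q \<xi> =
    (\<Sum>(i, i')\<in>ordered_pairs n. \<Sum>(j, j')\<in>ordered_pairs n.
       cos (2 * pi * real_of_int (minor \<xi> i i' j j') / real q)) / real (card (ordered_pairs n)) ^ 2"
proof -
  let ?m = "real (card (ordered_pairs n))"
  have inner: "(\<Sum>j<n. \<Sum>j'<n. osc q (minor \<xi> i i' j j'))
      = 2 * (\<Sum>(j, j')\<in>ordered_pairs n. osc q (minor \<xi> i i' j j'))" for i i'
  proof (rule sum_ordered_pairs)
    show "osc q (minor \<xi> i i' j j) = 0" for j by (simp add: minor_def)
    show "osc q (minor \<xi> i i' j j') = osc q (minor \<xi> i i' j' j)" for j j'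
      using osc_minus[of q "minor \<xi> i i' j j'"] by (simp add: minor_def algebra_simps)
  qed
  have "(\<Sum>i<n. \<Sum>i'<n. \<Sum>(j, j')\<in>ordered_pairs n. osc q (minor \<xi> i i' j j'))
      = 2 * (\<Sum>(i, i')\<in>ordered_pairs n. \<Sum>(j, j')\<in>ordered_pairs n. osc q (minor \<xi> i i' j j'))"
  proof (rule sum_ordered_pairs)
    show "(\<Sum>(j, j')\<in>ordered_pairs n. osc q (minor \<xi> i i j j')) = 0" for i by (simp add: minor_def)
    have "osc q (minor \<xi> i i' j j') = osc q (minor \<xi> i' i j j')" for i i' j j'
      using osc_minus[of q "minor \<xi> i i' j j'"] by (simp add: minor_def algebra_simps)
    then show "(\<Sum>(j, j')\<in>ordered_pairs n. osc q (minor \<xi> i i' j j'))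
       = (\<Sum>(j, j')\<in>ordered_pairs n. osc q (minor \<xi> i' i j j'))" for i i'
      by presburger
  qed
  then have "(\<Sum>i<n. \<Sum>i'<n. \<Sum>j<n. \<Sum>j'<n. osc q (minor \<xi> i i' j j'))
      = 4 * (\<Sum>(i, i')\<in>ordered_pairs n. \<Sum>(j, j')\<in>ordered_pairs n. osc q (minor \<xi> i i' j j'))"
    by (simp add: inner sum_distrib_left[symmetric])
  also have "\<dots> = 4 * (?m ^ 2 - (\<Sum>(i, i')\<in>ordered_pairs n. \<Sum>(j, j')\<in>ordered_pairs n.
       cos (2 * pi * real_of_int (minor \<xi> i i' j j') / real q)))"
    by (simp add: osc_def sum_subtractf case_prod_beta power2_eq_square)
  finally have *: "(\<Sum>i<n. \<Sum>i'<n. \<Sum>j<n. \<Sum>j'<n. osc q (minor \<xi> i i' j j')) = \<dots>" .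
  have "real n ^ 2 * (real n - 1) ^ 2 = (2 * ?m) ^ 2"
    by (simp only: card_ordered_pairs power_mult_distrib)
  then have "gap n q \<xi> = (?m ^ 2 - (\<Sum>(i, i')\<in>ordered_pairs n. \<Sum>(j, j')\<in>ordered_pairs n.
       cos (2 * pi * real_of_int (minor \<xi> i i' j j') / real q))) / ?m ^ 2"
    unfolding gap_def * by (simp add: power_mult_distrib right_diff_distrib[symmetric] del: right_diff_distrib_numeral)
  moreover have "?m \<noteq> 0"
  proof
    assume "?m = 0"
    then have "real n * (real n - 1) = 0"
      using card_ordered_pairs[of n] by simp
    with assms show False by auto
  qed
  ultimately show ?thesis
    by (simp add: diff_divide_distrib)
qed

lemma dg_P_sum:
  assumes "x \<in> tables n q r c" "q > 0"
  shows "(\<Sum>y\<in>tables n q r c. dg_P n q x y * h y) =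
    (\<Sum>(i, i')\<in>ordered_pairs n. \<Sum>(j, j')\<in>ordered_pairs n. \<Sum>s\<in>{1, -1::int}.
       h (apply_move n q x i i' j j' s)) / (2 * real (card (ordered_pairs n)) ^ 2)"
proof -
  let ?\<Omega> = "tables n q r c" and ?O = "ordered_pairs n"
  have hit: "(\<Sum>y\<in>?\<Omega>. (if apply_move n q x i i' j j' s = y then 1 else 0) * h y)
      = h (apply_move n q x i i' j j' s)" if "(i, i') \<in> ?O" "(j, j') \<in> ?O" for i i' j j' s
  proof -
    have "apply_move n q x i i' j j' s \<in> ?\<Omega>"
      using that assms by (intro apply_move_in_tables) (auto simp: ordered_pairs_def)
    then show ?thesis
      using finite_tables by (simp add: if_distrib[where f = "\<lambda>u. u * _"] cong: if_cong)
  qed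
  have "(\<Sum>y\<in>?\<Omega>. dg_P n q x y * h y) = (\<Sum>y\<in>?\<Omega>. \<Sum>p\<in>?O. \<Sum>p'\<in>?O. \<Sum>s\<in>{1, -1::int}.
      (if apply_move n q x (fst p) (snd p) (fst p') (snd p') s = y then 1 else 0) * h y)
        / (2 * real (card ?O) ^ 2)"
    unfolding dg_P_def case_prod_beta by (simp only: sum_divide_distrib sum_distrib_right times_divide_eq_left)
  also have "(\<Sum>y\<in>?\<Omega>. \<Sum>p\<in>?O. \<Sum>p'\<in>?O. \<Sum>s\<in>{1, -1::int}.
      (if apply_move n q x (fst p) (snd p) (fst p') (snd p') s = y then 1 else 0) * h y)
    = (\<Sum>p\<in>?O. \<Sum>y\<in>?\<Omega>. \<Sum>p'\<in>?O. \<Sum>s\<in>{1, -1::int}.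
      (if apply_move n q x (fst p) (snd p) (fst p') (snd p') s = y then 1 else 0) * h y)"
    by (rule sum.swap)
  also have "\<dots> = (\<Sum>p\<in>?O. \<Sum>p'\<in>?O. \<Sum>y\<in>?\<Omega>. \<Sum>s\<in>{1, -1::int}.
      (if apply_move n q x (fst p) (snd p) (fst p') (snd p') s = y then 1 else 0) * h y)"
    by (intro sum.cong refl sum.swap)
  also have "\<dots> = (\<Sum>p\<in>?O. \<Sum>p'\<in>?O. \<Sum>s\<in>{1, -1::int}. \<Sum>y\<in>?\<Omega>.
      (if apply_move n q x (fst p) (snd p) (fst p') (snd p') s = y then 1 else 0) * h y)"
    by (intro sum.cong refl sum.swap)
  also have "\<dots> = (\<Sum>p\<in>?O. \<Sum>p'\<in>?O. \<Sum>s\<in>{1, -1::int}. h (apply_move n q x (fst p) (snd p) (fst p') (snd p') s))"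
    by (intro sum.cong refl hit) auto
  finally show ?thesis
    by (simp add: case_prod_beta)
qed

text \<open>The two signs of a move average cos (\<theta> + \<eta>) and cos (\<theta> - \<eta>) to
  cos \<theta> cos \<eta>, so no sine term survives. The free shift \<open>\<phi>\<close> covers
  real and imaginary parts of the character at once and keeps the eigenvalue equation real.\<close>

lemma dg_P_eigen:
  assumes "x \<in> tables n q r c" "q > 0" "n \<ge> 2"
  shows "(\<Sum>y\<in>tables n q r c. dg_P n q x y * cos (phase n q \<xi> y - \<phi>))
    = (1 - gap n q \<xi>) * cos (phase n q \<xi> x - \<phi>)"
proof -
  let ?O = "ordered_pairs n" and ?m = "real (card (ordered_pairs n))"
  have two: "(\<Sum>s\<in>{1, -1::int}. cos (phase n q \<xi> (apply_move n q x i i' j j' s) - \<phi>))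
     = 2 * cos (phase n q \<xi> x - \<phi>) * cos (2 * pi * real_of_int (minor \<xi> i i' j j') / real q)"
    if "(i, i') \<in> ?O" "(j, j') \<in> ?O" for i i' j j'
  proof -
    have "cos (phase n q \<xi> (apply_move n q x i i' j j' s) - \<phi>) =
        cos (phase n q \<xi> x - \<phi> + 2 * pi * real_of_int (s * minor \<xi> i i' j j') / real q)" for s
      by (rule cos_phase_apply_move) (use that assms in \<open>auto simp: ordered_pairs_def\<close>)
    then show ?thesis
      by (simp add: cos_add)
  qed
  have "(\<Sum>(i, i')\<in>?O. \<Sum>(j, j')\<in>?O. \<Sum>s\<in>{1, -1::int}.
       cos (phase n q \<xi> (apply_move n q x i i' j j' s) - \<phi>))
    = (\<Sum>(i, i')\<in>?O. \<Sum>(j, j')\<in>?O. 2 * cos (phase n q \<xi> x - \<phi>) * cos (2 * pi * real_of_int (minor \<xi> i i' j j') / real q))"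
    unfolding case_prod_beta by (intro sum.cong refl two) auto
  also have "\<dots> = 2 * cos (phase n q \<xi> x - \<phi>) * (\<Sum>(i, i')\<in>?O. \<Sum>(j, j')\<in>?O. cos (2 * pi * real_of_int (minor \<xi> i i' j j') / real q))"
    by (simp add: case_prod_beta sum_distrib_left)
  finally show ?thesis
    unfolding dg_P_sum[OF assms(1,2)] gap_eq_ordered[OF assms(3)] by simp
qed

lemma dg_Pk_eigen:
  assumes "x \<in> tables n q r c" "q > 0" "n \<ge> 2"
  shows "(\<Sum>y\<in>tables n q r c. dg_Pk n q r c k x y * cos (phase n q \<xi> y - \<phi>))
    = (1 - gap n q \<xi>) ^ k * cos (phase n q \<xi> x - \<phi>)"
proof (induction k)
  case 0
  then show ?case
    using assms(1) finite_tables by (simp add: if_distrib[where f = "\<lambda>u. u * _"] cong: if_cong)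
next
  case (Suc k)
  let ?\<Omega> = "tables n q r c"
  have "(\<Sum>y\<in>?\<Omega>. dg_Pk n q r c (Suc k) x y * cos (phase n q \<xi> y - \<phi>))
     = (\<Sum>y\<in>?\<Omega>. \<Sum>z\<in>?\<Omega>. dg_Pk n q r c k x z * (dg_P n q z y * cos (phase n q \<xi> y - \<phi>)))"
    by (simp add: sum_distrib_right mult.assoc)
  also have "\<dots> = (\<Sum>z\<in>?\<Omega>. dg_Pk n q r c k x z * (\<Sum>y\<in>?\<Omega>. dg_P n q z y * cos (phase n q \<xi> y - \<phi>)))"
    by (subst sum.swap) (simp add: sum_distrib_left)
  also have "\<dots> = (1 - gap n q \<xi>) * (\<Sum>z\<in>?\<Omega>. dg_Pk n q r c k x z * cos (phase n q \<xi> z - \<phi>))"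
    by (simp add: dg_P_eigen[OF _ assms(2,3)] sum_distrib_left mult_ac cong: sum.cong)
  finally show ?case
    by (simp add: Suc mult.assoc)
qed

lemma dg_Pk_nonneg: "0 \<le> dg_Pk n q r c k x y"
proof -
  have "0 \<le> dg_P n q x y" for x y
    unfolding dg_P_def case_prod_beta by (intro divide_nonneg_nonneg sum_nonneg) auto
  then show ?thesis
    by (induction k arbitrary: y) (auto intro!: sum_nonneg mult_nonneg_nonneg)
qed

text \<open>Representatives of \<open>R\<^sup>n\<close> modulo constant functions, for a group \<open>R\<close> with zero \<open>z\<close>.  Applied twice,
  they represent the characters of the group of tables with zero margins.\<close>

definition based_funs :: "nat \<Rightarrow> 'a set \<Rightarrow> 'a \<Rightarrow> (nat \<Rightarrow> 'a) set" where
  "based_funs n R z = Pi\<^sub>E {..<n} (\<lambda>i. if i = 0 then {z} else R)"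

definition const_fun :: "nat \<Rightarrow> 'a \<Rightarrow> nat \<Rightarrow> 'a" where
  "const_fun n z = (\<lambda>i\<in>{..<n}. z)"

definition duals :: "nat \<Rightarrow> nat \<Rightarrow> (nat \<Rightarrow> nat \<Rightarrow> int) set" where
  "duals n q = based_funs n (based_funs n {0..<int q} 0) (const_fun n 0)"

definition dual0 :: "nat \<Rightarrow> nat \<Rightarrow> nat \<Rightarrow> int" where
  "dual0 n = const_fun n (const_fun n 0)"

lemma finite_based_funs: "finite R \<Longrightarrow> finite (based_funs n R z)"
  by (auto simp: based_funs_def intro!: finite_PiE)

lemma const_fun_in_based_funs: "z \<in> R \<Longrightarrow> const_fun n z \<in> based_funs n R z"
  by (auto simp: based_funs_def const_fun_def)

lemma based_funsD:
  assumes "x \<in> based_funs n R z"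
  shows "i < n \<Longrightarrow> i = 0 \<Longrightarrow> x i = z" "i < n \<Longrightarrow> i \<noteq> 0 \<Longrightarrow> x i \<in> R" "x \<in> extensional {..<n}"
  using assms PiE_mem[OF assms[unfolded based_funs_def], of i] by (auto simp: based_funs_def PiE_def)

lemma finite_duals: "finite (duals n q)"
  by (simp add: duals_def finite_based_funs)

lemma dual0_in_duals: "q > 0 \<Longrightarrow> dual0 n \<in> duals n q"
  by (simp add: duals_def dual0_def const_fun_in_based_funs)

lemma dualsD:
  assumes "\<xi> \<in> duals n q" "a < n" "b < n"
  shows "a = 0 \<or> b = 0 \<Longrightarrow> \<xi> a b = 0" and "q > 0 \<Longrightarrow> 0 \<le> \<xi> a b \<and> \<xi> a b < int q"
  using assms based_funsD(1,2)[OF assms(1)[unfolded duals_def] assms(2)] based_funsD(1,2)[of "\<xi> a" n _ _ b]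
  by (cases "a = 0"; cases "b = 0"; force simp: const_fun_def)+

lemma gap_pos_of_minor:
  assumes "q > 0" "n \<ge> 2" "i < n" "i' < n" "j < n" "j' < n" "\<not> int q dvd minor \<xi> i i' j j'"
  shows "gap n q \<xi> > 0"
proof -
  have pos: "0 < osc q (minor \<xi> i i' j j')"
  proof -
    have "osc q (minor \<xi> i i' j j') \<noteq> 0"
    proof
      assume "osc q (minor \<xi> i i' j j') = 0"
      then obtain m :: int where "2 * pi * real_of_int (minor \<xi> i i' j j') / real q = real_of_int m * 2 * pi"
        by (auto simp: osc_def cos_one_2pi_int)
      then have "real_of_int (minor \<xi> i i' j j') = real_of_int (int q * m)"
        using assms(1) by (simp add: field_simps)
      then have "minor \<xi> i i' j j' = int q * m"
        by linarith
      then show False using assms(7) by simp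
    qed
    then show ?thesis
      using osc_nonneg[of q "minor \<xi> i i' j j'"] by linarith
  qed
  have "osc q (minor \<xi> i i' j j') \<le> (\<Sum>j'<n. osc q (minor \<xi> i i' j j'))"
    using assms by (intro member_le_sum[of j' _ "\<lambda>j'. osc q (minor \<xi> i i' j j')"]) (auto intro: osc_nonneg)
  also have "\<dots> \<le> (\<Sum>j<n. \<Sum>j'<n. osc q (minor \<xi> i i' j j'))"
    using assms by (intro member_le_sum[of j _ "\<lambda>j. \<Sum>j'<n. osc q (minor \<xi> i i' j j')"]) (auto intro!: sum_nonneg osc_nonneg)
  also have "\<dots> \<le> (\<Sum>i'<n. \<Sum>j<n. \<Sum>j'<n. osc q (minor \<xi> i i' j j'))"
    using assms by (intro member_le_sum[of i' _ "\<lambda>i'. \<Sum>j<n. \<Sum>j'<n. osc q (minor \<xi> i i' j j')"]) (auto intro!: sum_nonneg osc_nonneg)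
  also have "\<dots> \<le> (\<Sum>i<n. \<Sum>i'<n. \<Sum>j<n. \<Sum>j'<n. osc q (minor \<xi> i i' j j'))"
    using assms by (intro member_le_sum[of i _ "\<lambda>i. \<Sum>i'<n. \<Sum>j<n. \<Sum>j'<n. osc q (minor \<xi> i i' j j')"]) (auto intro!: sum_nonneg osc_nonneg)
  finally show ?thesis
    unfolding gap_def using pos assms(2) by (intro divide_pos_pos) auto
qed

lemma gap_dual0: "gap n q (dual0 n) = 0"
  by (simp add: gap_def minor_def dual0_def const_fun_def)

lemma gap_dual_pos:
  assumes "\<xi> \<in> duals n q" "\<xi> \<noteq> dual0 n" "q > 0" "n \<ge> 2"
  shows "gap n q \<xi> > 0"
proof -
  have "\<exists>a<n. \<exists>b<n. \<xi> a b \<noteq> 0"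
  proof (rule ccontr)
    assume "\<not> ?thesis"
    then have z: "\<xi> a b = 0" if "a < n" "b < n" for a b using that by blast
    have "\<xi> a = const_fun n 0" if "a < n" for a
    proof -
      have "\<xi> a \<in> extensional {..<n}"
        using based_funsD(1,2)[OF assms(1)[unfolded duals_def] that] based_funsD(3)[of "\<xi> a" n]
        by (cases "a = 0") (auto simp: const_fun_def)
      then show ?thesis
        using z[OF that] by (intro extensionalityI[of _ "{..<n}"]) (auto simp: const_fun_def)
    qed
    moreover have "\<xi> \<in> extensional {..<n}"
      using assms(1) by (simp add: duals_def based_funs_def PiE_def)
    ultimately have "\<xi> = dual0 n"
      by (auto simp: fun_eq_iff dual0_def const_fun_def extensional_def)
    with assms(2) show False by simp
  qed
  then obtain a b where ab: "a < n" "b < n" "\<xi> a b \<noteq> 0" by blast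
  \<comment> \<open>Row 0 and column 0 of a representative vanish, so the minor based at the corner
    is the entry itself.\<close>
  have "minor \<xi> a 0 b 0 = \<xi> a b"
    using dualsD(1)[OF assms(1)] ab by (simp add: minor_def)
  moreover have "\<not> int q dvd \<xi> a b"
    using dualsD(2)[OF assms(1) ab(1,2) assms(3)] ab(3) by (auto dest: zdvd_imp_le)
  ultimately show ?thesis
    using gap_pos_of_minor[of q n a 0 b 0 \<xi>] assms ab by auto
qed

section \<open>Orthogonality of the characters and Fourier inversion\<close>

lemma sum_roots_of_unity:
  assumes "q > 0"
  shows "(\<Sum>k\<in>{0..<int q}. cis (2 * pi * real_of_int (k * u) / real q)) = (if int q dvd u then of_nat q else 0)"
proof -
  define z where "z = cis (2 * pi * real_of_int u / real q)"
  have "(\<Sum>k\<in>{0..<int q}. cis (2 * pi * real_of_int (k * u) / real q)) = (\<Sum>k\<in>int ` {..<q}. cis (2 * pi * real_of_int (k * u) / real q))"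
    by (simp add: image_int_atLeastLessThan lessThan_atLeast0)
  also have "\<dots> = (\<Sum>k<q. z ^ k)"
    by (subst sum.reindex) (auto simp: z_def Complex.DeMoivre mult_ac)
  finally have *: "(\<Sum>k\<in>{0..<int q}. cis (2 * pi * real_of_int (k * u) / real q)) = (\<Sum>k<q. z ^ k)" .
  show ?thesis
  proof (cases "int q dvd u")
    case True
    then obtain m where "u = int q * m" by auto
    then have "z = cis (2 * pi * real_of_int m)"
      unfolding z_def using assms by (intro arg_cong[where f = cis]) simp
    then have "z = 1"
      by (simp only: cis.code cos_int_2pin sin_int_2pin one_complex.code)
    then show ?thesis using True unfolding * by simp
  next
    case False
    have "z \<noteq> 1"
    proof
      assume "z = 1"
      then have "cos (2 * pi * real_of_int u / real q) = 1"
        by (simp add: z_def complex_eq_iff)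
      then obtain m :: int where "2 * pi * real_of_int u / real q = real_of_int m * 2 * pi"
        by (auto simp: cos_one_2pi_int)
      then have "real_of_int u = real_of_int (int q * m)"
        using assms by (simp add: field_simps)
      then have "u = int q * m" by linarith
      then show False using False by simp
    qed
    moreover have "z ^ q = 1"
      using assms by (simp add: z_def Complex.DeMoivre)
    ultimately show ?thesis
      using False unfolding * by (simp add: geometric_sum)
  qed
qed

lemma cis_sum: "finite A \<Longrightarrow> cis (\<Sum>a\<in>A. f a) = (\<Prod>a\<in>A. cis (f a))"
  by (induction A rule: finite_induct) (auto simp: cis_mult[symmetric])

lemma sum_based_funs_prod:
  fixes g :: "nat \<Rightarrow> 'a \<Rightarrow> 'b::comm_semiring_1"
  assumes "finite R" "g 0 z = 1"
  shows "(\<Sum>x\<in>based_funs n R z. \<Prod>a<n. g a (x a)) = (\<Prod>a\<in>{1..<n}. \<Sum>w\<in>R. g a w)"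
proof -
  have "(\<Sum>x\<in>based_funs n R z. \<Prod>a<n. g a (x a)) = (\<Prod>a<n. \<Sum>w\<in>(if a = 0 then {z} else R). g a w)"
    unfolding based_funs_def by (rule prod_sum_PiE[symmetric]) (use assms in auto)
  also have "\<dots> = (\<Prod>a\<in>{1..<n}. \<Sum>w\<in>(if a = 0 then {z} else R). g a w)"
    by (rule prod.mono_neutral_right) (use assms in \<open>auto split: if_splits\<close>)
  also have "\<dots> = (\<Prod>a\<in>{1..<n}. \<Sum>w\<in>R. g a w)"
    by (rule prod.cong) auto
  finally show ?thesis .
qed

text \<open>The sum factorises over the entries outside row 0 and column 0, each factor being a full
  sum of powers of a root of unity. Row 0 and column 0 of \<open>u\<close> are invisible to these
  characters.\<close>

lemma sum_duals_cis:
  assumes "q > 0"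
  shows "(\<Sum>\<xi>\<in>duals n q. cis (phase n q \<xi> u)) =
    (if \<forall>a\<in>{1..<n}. \<forall>b\<in>{1..<n}. int q dvd u a b then of_nat (q ^ (n - 1) ^ 2) else 0)"
proof -
  let ?R = "based_funs n {0..<int q} 0"
  have ph: "phase n q \<xi> u = (\<Sum>a<n. \<Sum>b<n. 2 * pi * real_of_int (\<xi> a b * u a b) / real q)" for \<xi>
    by (simp add: phase_def sum_distrib_left sum_divide_distrib)
  have "(\<Sum>\<xi>\<in>duals n q. cis (phase n q \<xi> u))
     = (\<Sum>\<xi>\<in>based_funs n ?R (const_fun n 0). \<Prod>a<n. \<Prod>b<n. cis (2 * pi * real_of_int (\<xi> a b * u a b) / real q))"
    by (simp add: duals_def ph cis_sum)
  also have "\<dots> = (\<Prod>a\<in>{1..<n}. \<Sum>w\<in>?R. \<Prod>b<n. cis (2 * pi * real_of_int (w b * u a b) / real q))"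
    by (rule sum_based_funs_prod) (auto simp: finite_based_funs const_fun_def)
  also have "\<dots> = (\<Prod>a\<in>{1..<n}. \<Prod>b\<in>{1..<n}. \<Sum>k\<in>{0..<int q}. cis (2 * pi * real_of_int (k * u a b) / real q))"
    by (intro prod.cong refl sum_based_funs_prod) auto
  also have "\<dots> = (\<Prod>a\<in>{1..<n}. \<Prod>b\<in>{1..<n}. if int q dvd u a b then of_nat q else 0)"
    by (simp only: sum_roots_of_unity[OF assms])
  also have "\<dots> = (if \<forall>a\<in>{1..<n}. \<forall>b\<in>{1..<n}. int q dvd u a b then of_nat (q ^ (n - 1) ^ 2) else 0)"
  proof (cases "\<forall>a\<in>{1..<n}. \<forall>b\<in>{1..<n}. int q dvd u a b")
    case True
    then have "(\<Prod>a\<in>{1..<n}. \<Prod>b\<in>{1..<n}. if int q dvd u a b then of_nat q else 0)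
        = (\<Prod>a\<in>{1..<n}. \<Prod>b\<in>{1..<n}. complex_of_nat q)"
      by (intro prod.cong refl) auto
    with True show ?thesis by (simp add: power_mult[symmetric] power2_eq_square)
  next
    case False
    then have "\<exists>a\<in>{1..<n}. (\<Prod>b\<in>{1..<n}. if int q dvd u a b then of_nat q else 0) = (0::complex)"
      by (auto simp: prod_zero_iff)
    then have "(\<Prod>a\<in>{1..<n}. \<Prod>b\<in>{1..<n}. if int q dvd u a b then of_nat q else 0) = (0::complex)"
      by (subst prod_zero_iff) auto
    with False show ?thesis by (simp only: if_False)
  qed
  finally show ?thesis .
qed

lemma phase_diff: "phase n q \<xi> x - phase n q \<xi> y = phase n q \<xi> (\<lambda>a b. x a b - y a b)"
  by (simp add: phase_def right_diff_distrib sum_subtractf diff_divide_distrib)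

text \<open>The margins recover what the characters do not see: the row sums give column 0 below the
  corner, after which the column sums give all of row 0, corner included.\<close>

lemma tables_eqI:
  assumes x: "x \<in> tables n q r c" and y: "y \<in> tables n q r c"
    and eq: "\<And>a b. a \<in> {1..<n} \<Longrightarrow> b \<in> {1..<n} \<Longrightarrow> int q dvd x a b - y a b"
  shows "x = y"
proof -
  have entry: "x a b = y a b" if "a < n" "b < n" "int q dvd x a b - y a b" for a b
  proof -
    have "x a b mod int q = y a b mod int q"
      using that(3) by (simp add: mod_eq_dvd_iff)
    moreover have "0 \<le> x a b" "x a b < int q" "0 \<le> y a b" "y a b < int q"
      using x y that by (auto simp: tables_def)
    ultimately show ?thesis by simp
  qed
  have split: "(\<Sum>b<n. f b) = f 0 + (\<Sum>b\<in>{1..<n}. f b)" if "0 < n" for f :: "nat \<Rightarrow> int"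
    using that by (simp add: lessThan_atLeast0 sum.atLeast_Suc_lessThan)
  have col: "x a 0 = y a 0" if "a \<in> {1..<n}" for a
  proof (rule entry)
    have "(\<Sum>b<n. x a b) mod int q = (\<Sum>b<n. y a b) mod int q"
      using x y that by (auto simp: tables_def)
    then have "int q dvd (\<Sum>b<n. x a b) - (\<Sum>b<n. y a b)"
      by (simp add: mod_eq_dvd_iff)
    moreover have "(\<Sum>b\<in>{1..<n}. x a b) = (\<Sum>b\<in>{1..<n}. y a b)"
      using that by (intro sum.cong refl entry eq) auto
    ultimately show "int q dvd x a 0 - y a 0"
      using that by (simp add: split)
  qed (use that in auto)
  have pos: "x a b = y a b" if "a \<in> {1..<n}" "b < n" for a b
    using that col[of a] entry[of a b] eq[of a b] by (cases "b = 0") auto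
  have row: "x 0 b = y 0 b" if "b < n" for b
  proof (rule entry)
    have "(\<Sum>a<n. x a b) mod int q = (\<Sum>a<n. y a b) mod int q"
      using x y that by (auto simp: tables_def)
    then have "int q dvd (\<Sum>a<n. x a b) - (\<Sum>a<n. y a b)"
      by (simp add: mod_eq_dvd_iff)
    moreover have "(\<Sum>a\<in>{1..<n}. x a b) = (\<Sum>a\<in>{1..<n}. y a b)"
      using that by (intro sum.cong refl pos) auto
    ultimately show "int q dvd x 0 b - y 0 b"
      using that by (simp add: split)
  qed (use that in auto)
  show ?thesis
  proof (intro ext)
    fix a b
    show "x a b = y a b"
    proof (cases "a < n \<and> b < n")
      case True
      then show ?thesis using row[of b] pos[of a b] by (cases "a = 0") auto
    next
      case False
      then show ?thesis using x y unfolding tables_def by (metis (mono_tags, lifting) mem_Collect_eq)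
    qed
  qed
qed

lemma sum_duals_cos:
  assumes "x \<in> tables n q r c" "y \<in> tables n q r c" "q > 0"
  shows "(\<Sum>\<xi>\<in>duals n q. cos (phase n q \<xi> x - phase n q \<xi> y)) = (if x = y then real q ^ (n - 1) ^ 2 else 0)"
proof -
  let ?P = "\<forall>a\<in>{1..<n}. \<forall>b\<in>{1..<n}. int q dvd x a b - y a b"
  have iff: "?P \<longleftrightarrow> x = y"
    using tables_eqI[OF assms(1,2)] by auto
  have "(\<Sum>\<xi>\<in>duals n q. cos (phase n q \<xi> x - phase n q \<xi> y)) = Re (\<Sum>\<xi>\<in>duals n q. cis (phase n q \<xi> (\<lambda>a b. x a b - y a b)))"
    by (simp add: phase_diff)
  also have "\<dots> = Re (if ?P then of_nat (q ^ (n - 1) ^ 2) else 0)"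
    by (simp only: sum_duals_cis[OF assms(3)])
  finally show ?thesis
    unfolding iff by simp
qed

text \<open>The indicator of \<open>y\<close> is expanded in characters, and each of them is
  propagated by its eigenvalue. Only orthogonality in the sum over \<open>\<xi>\<close> enters; the
  number of tables is not yet known here.\<close>

lemma dg_Pk_fourier:
  assumes "x \<in> tables n q r c" "y \<in> tables n q r c" "q > 0" "n \<ge> 2"
  shows "dg_Pk n q r c k x y =
    (\<Sum>\<xi>\<in>duals n q. (1 - gap n q \<xi>) ^ k * cos (phase n q \<xi> x - phase n q \<xi> y)) / real q ^ (n - 1) ^ 2"
proof -
  let ?\<Omega> = "tables n q r c" and ?D = "real q ^ (n - 1) ^ 2"
  have "(\<Sum>\<xi>\<in>duals n q. (1 - gap n q \<xi>) ^ k * cos (phase n q \<xi> x - phase n q \<xi> y))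
     = (\<Sum>\<xi>\<in>duals n q. \<Sum>z\<in>?\<Omega>. dg_Pk n q r c k x z * cos (phase n q \<xi> z - phase n q \<xi> y))"
    by (simp add: dg_Pk_eigen[OF assms(1,3,4)])
  also have "\<dots> = (\<Sum>z\<in>?\<Omega>. dg_Pk n q r c k x z * (\<Sum>\<xi>\<in>duals n q. cos (phase n q \<xi> z - phase n q \<xi> y)))"
    by (subst sum.swap) (simp add: sum_distrib_left)
  also have "\<dots> = (\<Sum>z\<in>?\<Omega>. dg_Pk n q r c k x z * (if z = y then ?D else 0))"
    by (intro sum.cong refl) (simp add: sum_duals_cos[OF _ assms(2,3)])
  also have "\<dots> = dg_Pk n q r c k x y * ?D"
    using assms(2) finite_tables by (simp add: if_distrib[where f = "\<lambda>u. _ * u"] cong: if_cong)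
  finally show ?thesis
    using assms(3) by simp
qed

section \<open>Passage to continuous time\<close>

lemma poisson_power_sums:
  fixes t g :: real
  shows "(\<lambda>k. exp (- t) * t ^ k / fact k * (1 - g) ^ k) sums exp (- t * g)"
proof -
  have "(\<lambda>k. exp (- t) * ((t * (1 - g)) ^ k /\<^sub>R fact k)) sums (exp (- t) * exp (t * (1 - g)))"
    by (intro sums_mult exp_converges)
  moreover have "exp (- t) * exp (t * (1 - g)) = exp (- t * g)"
    by (simp only: exp_add[symmetric]) (simp add: algebra_simps)
  ultimately show ?thesis
    by (simp add: power_mult_distrib divide_inverse mult_ac)
qed

text \<open>Stated with \<open>sums\<close> because the summability itself is used later, for the
  nonnegativity of \<open>dg_H\<close> and for summing its series over tables.\<close>

lemma dg_H_sums:
  assumes "x \<in> tables n q r c" "y \<in> tables n q r c" "q > 0" "n \<ge> 2"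
  shows "(\<lambda>k. exp (- t) * t ^ k / fact k * dg_Pk n q r c k x y) sums
    ((\<Sum>\<xi>\<in>duals n q. exp (- t * gap n q \<xi>) * cos (phase n q \<xi> x - phase n q \<xi> y)) / real q ^ (n - 1) ^ 2)"
proof -
  have "(\<lambda>k. (\<Sum>\<xi>\<in>duals n q. (exp (- t) * t ^ k / fact k * (1 - gap n q \<xi>) ^ k)
       * cos (phase n q \<xi> x - phase n q \<xi> y)) / real q ^ (n - 1) ^ 2) sums
    ((\<Sum>\<xi>\<in>duals n q. exp (- t * gap n q \<xi>) * cos (phase n q \<xi> x - phase n q \<xi> y)) / real q ^ (n - 1) ^ 2)"
    by (intro sums_divide sums_sum sums_mult2 poisson_power_sums)
  moreover have "(\<lambda>k. (\<Sum>\<xi>\<in>duals n q. (exp (- t) * t ^ k / fact k * (1 - gap n q \<xi>) ^ k)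
       * cos (phase n q \<xi> x - phase n q \<xi> y)) / real q ^ (n - 1) ^ 2)
    = (\<lambda>k. exp (- t) * t ^ k / fact k * dg_Pk n q r c k x y)"
    by (simp add: dg_Pk_fourier[OF assms] sum_distrib_left mult.assoc)
  ultimately show ?thesis by simp
qed

lemmas dg_H_fourier = sums_unique[OF dg_H_sums, folded dg_H_def, symmetric]

lemma dg_H_nonneg:
  assumes "x \<in> tables n q r c" "y \<in> tables n q r c" "q > 0" "n \<ge> 2" "t \<ge> 0"
  shows "0 \<le> dg_H n q r c t x y"
  unfolding dg_H_def using assms(5)
  by (intro suminf_nonneg sums_summable[OF dg_H_sums[OF assms(1-4)]])
     (auto intro!: mult_nonneg_nonneg divide_nonneg_nonneg dg_Pk_nonneg)

lemma dg_H_eigen: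
  assumes "x \<in> tables n q r c" "q > 0" "n \<ge> 2"
  shows "(\<Sum>y\<in>tables n q r c. dg_H n q r c t x y * cos (phase n q \<xi> y - \<phi>))
    = exp (- t * gap n q \<xi>) * cos (phase n q \<xi> x - \<phi>)"
proof (rule sums_unique2)
  have s: "(\<lambda>k. exp (- t) * t ^ k / fact k * dg_Pk n q r c k x y) sums dg_H n q r c t x y"
    if "y \<in> tables n q r c" for y
    unfolding dg_H_def by (rule summable_sums[OF sums_summable[OF dg_H_sums]]) (use that assms in auto)
  show "(\<lambda>k. \<Sum>y\<in>tables n q r c. (exp (- t) * t ^ k / fact k * dg_Pk n q r c k x y) * cos (phase n q \<xi> y - \<phi>))
     sums (\<Sum>y\<in>tables n q r c. dg_H n q r c t x y * cos (phase n q \<xi> y - \<phi>))"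
    by (intro sums_sum sums_mult2 s)
  have "(\<lambda>k. \<Sum>y\<in>tables n q r c. (exp (- t) * t ^ k / fact k * dg_Pk n q r c k x y) * cos (phase n q \<xi> y - \<phi>))
     = (\<lambda>k. exp (- t) * t ^ k / fact k * (1 - gap n q \<xi>) ^ k * cos (phase n q \<xi> x - \<phi>))"
    by (simp only: mult.assoc sum_distrib_left[symmetric] dg_Pk_eigen[OF assms])
  moreover have "\<dots> sums (exp (- t * gap n q \<xi>) * cos (phase n q \<xi> x - \<phi>))"
    by (intro sums_mult2 poisson_power_sums)
  ultimately show "(\<lambda>k. \<Sum>y\<in>tables n q r c. (exp (- t) * t ^ k / fact k * dg_Pk n q r c k x y) * cos (phase n q \<xi> y - \<phi>))
     sums (exp (- t * gap n q \<xi>) * cos (phase n q \<xi> x - \<phi>))" by simp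
qed

text \<open>The Fourier expansion for one step depends on the two tables only through the cosine of
  a phase difference, which is even; no move has to be inverted by hand.\<close>

lemma dg_P_sym:
  assumes "x \<in> tables n q r c" "y \<in> tables n q r c" "q > 0" "n \<ge> 2"
  shows "dg_P n q x y = dg_P n q y x"
proof -
  have "dg_P n q x y = dg_Pk n q r c 1 x y" if "x \<in> tables n q r c" for x y
    using that finite_tables by (simp add: if_distrib[where f = "\<lambda>u. u * _"] cong: if_cong)
  moreover have "dg_Pk n q r c 1 x y = dg_Pk n q r c 1 y x"
    unfolding dg_Pk_fourier[OF assms] dg_Pk_fourier[OF assms(2,1,3,4)]
    by (simp add: cos_diff mult_ac)
  ultimately show ?thesis using assms(1,2) by simp
qed

text \<open>Summing the eigenvalue equation against the (stationary) uniform distribution kills every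
  character with a positive gap.\<close>

lemma sum_tables_cos:
  assumes "gap n q \<xi> \<noteq> 0" "q > 0" "n \<ge> 2"
  shows "(\<Sum>y\<in>tables n q r c. cos (phase n q \<xi> y - \<phi>)) = 0"
proof -
  let ?\<Omega> = "tables n q r c"
  \<comment> \<open>The zero matrix gives the constant function 1 with gap 0, so the eigenvalue
    equation says that the transition probabilities sum to 1.\<close>
  have one: "(\<Sum>z\<in>?\<Omega>. dg_P n q y z) = 1" if "y \<in> ?\<Omega>" for y
    using dg_P_eigen[OF that assms(2,3), of "\<lambda>_ _. 0" 0]
    by (simp add: phase_def gap_def minor_def)
  have "(1 - gap n q \<xi>) * (\<Sum>y\<in>?\<Omega>. cos (phase n q \<xi> y - \<phi>))
     = (\<Sum>y\<in>?\<Omega>. \<Sum>z\<in>?\<Omega>. dg_P n q y z * cos (phase n q \<xi> z - \<phi>))"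
    by (simp add: dg_P_eigen[OF _ assms(2,3)] sum_distrib_left)
  also have "\<dots> = (\<Sum>z\<in>?\<Omega>. (\<Sum>y\<in>?\<Omega>. dg_P n q z y) * cos (phase n q \<xi> z - \<phi>))"
    by (subst sum.swap) (auto simp: sum_distrib_right dg_P_sym[OF _ _ assms(2,3)] intro!: sum.cong)
  also have "\<dots> = (\<Sum>z\<in>?\<Omega>. cos (phase n q \<xi> z - \<phi>))"
    by (simp add: one)
  finally show ?thesis
    using assms(1) by (simp add: algebra_simps)
qed

lemma sum_dg_H:
  assumes "x \<in> tables n q r c" "q > 0" "n \<ge> 2"
  shows "(\<Sum>y\<in>tables n q r c. dg_H n q r c t x y) = 1"
  using dg_H_eigen[OF assms, of t "\<lambda>_ _. 0" 0] by (simp add: phase_def gap_def minor_def)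

text \<open>Double counting over pairs of a table and a character: summing over characters first
  leaves only the table \<open>x\<close>, summing over tables first leaves only the trivial
  character.\<close>

lemma card_tables:
  assumes "tables n q r c \<noteq> {}" "q > 0" "n \<ge> 2"
  shows "real (card (tables n q r c)) = real q ^ (n - 1) ^ 2"
proof -
  let ?\<Omega> = "tables n q r c" and ?D = "real q ^ (n - 1) ^ 2"
  obtain x where x: "x \<in> ?\<Omega>" using assms(1) by blast
  have "?D = (\<Sum>y\<in>?\<Omega>. \<Sum>\<xi>\<in>duals n q. cos (phase n q \<xi> y - phase n q \<xi> x))"
    using x finite_tables by (simp add: sum_duals_cos[OF _ x assms(2)])
  also have "\<dots> = (\<Sum>\<xi>\<in>duals n q. \<Sum>y\<in>?\<Omega>. cos (phase n q \<xi> y - phase n q \<xi> x))"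
    by (rule sum.swap)
  also have "\<dots> = (\<Sum>\<xi>\<in>duals n q. if \<xi> = dual0 n then real (card ?\<Omega>) else 0)"
  proof (intro sum.cong refl)
    fix \<xi> assume "\<xi> \<in> duals n q"
    then show "(\<Sum>y\<in>?\<Omega>. cos (phase n q \<xi> y - phase n q \<xi> x)) = (if \<xi> = dual0 n then real (card ?\<Omega>) else 0)"
      using sum_tables_cos[OF _ assms(2,3)] gap_dual_pos[OF _ _ assms(2,3)]
      by (force simp: phase_def dual0_def const_fun_def)
  qed
  finally show ?thesis
    using dual0_in_duals[OF assms(2)] finite_duals by simp
qed

lemma sum_dg_H_squared:
  assumes "x \<in> tables n q r c" "q > 0" "n \<ge> 2"
  shows "(\<Sum>y\<in>tables n q r c. dg_H n q r c t x y ^ 2)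
     = (\<Sum>\<xi>\<in>duals n q. exp (- 2 * t * gap n q \<xi>)) / real (card (tables n q r c))"
proof -
  let ?\<Omega> = "tables n q r c" and ?D = "real q ^ (n - 1) ^ 2"
  have "(\<Sum>y\<in>?\<Omega>. dg_H n q r c t x y ^ 2) = (\<Sum>y\<in>?\<Omega>. \<Sum>\<xi>\<in>duals n q.
      exp (- t * gap n q \<xi>) * (dg_H n q r c t x y * cos (phase n q \<xi> y - phase n q \<xi> x))) / ?D"
    unfolding sum_divide_distrib
  proof (intro sum.cong refl)
    fix y assume "y \<in> ?\<Omega>"
    \<comment> \<open>Only one of the two factors is expanded. The other stays as a measure against
      which the eigenvalue equation integrates each character, so no double sum over characters
      arises.\<close>
    then have "dg_H n q r c t x y ^ 2 = dg_H n q r c t x y *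
        ((\<Sum>\<xi>\<in>duals n q. exp (- t * gap n q \<xi>) * cos (phase n q \<xi> x - phase n q \<xi> y)) / ?D)"
      using dg_H_fourier[OF assms(1) _ assms(2,3)] by (simp add: power2_eq_square)
    also have "\<dots> = (\<Sum>\<xi>\<in>duals n q. exp (- t * gap n q \<xi>) * (dg_H n q r c t x y * cos (phase n q \<xi> y - phase n q \<xi> x)) / ?D)"
      unfolding sum_distrib_left sum_divide_distrib
      by (intro sum.cong refl) (simp add: cos_diff algebra_simps add_divide_distrib)
    finally show "dg_H n q r c t x y ^ 2 = \<dots>" .
  qed
  also have "(\<Sum>y\<in>?\<Omega>. \<Sum>\<xi>\<in>duals n q.
      exp (- t * gap n q \<xi>) * (dg_H n q r c t x y * cos (phase n q \<xi> y - phase n q \<xi> x)))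
     = (\<Sum>\<xi>\<in>duals n q. exp (- t * gap n q \<xi>) * (\<Sum>y\<in>?\<Omega>. dg_H n q r c t x y * cos (phase n q \<xi> y - phase n q \<xi> x)))"
    by (subst sum.swap) (simp add: sum_distrib_left)
  also have "\<dots> = (\<Sum>\<xi>\<in>duals n q. exp (- 2 * t * gap n q \<xi>))"
    by (simp add: dg_H_eigen[OF assms] exp_add[symmetric] mult.assoc)
  also have "?D = real (card ?\<Omega>)"
    by (rule card_tables[symmetric]) (use assms in auto)
  finally show ?thesis .
qed

section \<open>Total variation distance through l1 and l2 norms\<close>

lemma abs_sum_diff_uniform_le:
  fixes p :: "'a \<Rightarrow> real"
  assumes "finite \<Omega>" "A \<subseteq> \<Omega>" "sum p \<Omega> = 1" "\<Omega> \<noteq> {}"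
  shows "\<bar>sum p A - real (card A) / real (card \<Omega>)\<bar> \<le> 1/2 * (\<Sum>y\<in>\<Omega>. \<bar>p y - 1 / real (card \<Omega>)\<bar>)"
proof -
  define e where "e y = p y - 1 / real (card \<Omega>)" for y
  have "sum e \<Omega> = 0"
    using assms by (simp add: e_def sum_subtractf)
  then have "sum e A = - sum e (\<Omega> - A)"
    using sum.subset_diff[OF assms(2,1), of e] by linarith
  moreover have "\<bar>sum e A\<bar> \<le> (\<Sum>y\<in>A. \<bar>e y\<bar>)" "\<bar>sum e (\<Omega> - A)\<bar> \<le> (\<Sum>y\<in>\<Omega> - A. \<bar>e y\<bar>)"
    by (rule sum_abs)+
  moreover have "(\<Sum>y\<in>\<Omega>. \<bar>e y\<bar>) = (\<Sum>y\<in>\<Omega> - A. \<bar>e y\<bar>) + (\<Sum>y\<in>A. \<bar>e y\<bar>)"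
    by (rule sum.subset_diff[OF assms(2,1)])
  ultimately have "\<bar>sum e A\<bar> \<le> 1/2 * (\<Sum>y\<in>\<Omega>. \<bar>e y\<bar>)"
    by linarith
  then show ?thesis
    by (simp add: e_def sum_subtractf)
qed

text \<open>The extremal set is where \<open>p\<close> is at least the uniform weight: the
  deviations sum to zero, so their positive part is half of the l1 norm.\<close>

lemma half_l1_le_abs_sum:
  fixes p :: "'a \<Rightarrow> real"
  assumes "finite \<Omega>" "sum p \<Omega> = 1" "\<Omega> \<noteq> {}"
  obtains A where "A \<subseteq> \<Omega>"
    "1/2 * (\<Sum>y\<in>\<Omega>. \<bar>p y - 1 / real (card \<Omega>)\<bar>) = \<bar>sum p A - real (card A) / real (card \<Omega>)\<bar>"
proof
  define e where "e y = p y - 1 / real (card \<Omega>)" for y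
  let ?A = "{y\<in>\<Omega>. e y \<ge> 0}"
  show sub: "?A \<subseteq> \<Omega>" by auto
  have "sum e \<Omega> = 0"
    using assms by (simp add: e_def sum_subtractf)
  then have "sum e ?A = - sum e (\<Omega> - ?A)"
    using sum.subset_diff[OF sub assms(1), of e] by simp
  moreover have "(\<Sum>y\<in>?A. \<bar>e y\<bar>) = sum e ?A" "(\<Sum>y\<in>\<Omega> - ?A. \<bar>e y\<bar>) = - sum e (\<Omega> - ?A)"
    by (auto simp: sum_negf[symmetric] intro!: sum.cong)
  moreover have "(\<Sum>y\<in>\<Omega>. \<bar>e y\<bar>) = (\<Sum>y\<in>\<Omega> - ?A. \<bar>e y\<bar>) + (\<Sum>y\<in>?A. \<bar>e y\<bar>)"
    by (rule sum.subset_diff[OF sub assms(1)])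
  moreover have "sum e ?A = sum p ?A - real (card ?A) / real (card \<Omega>)"
    by (simp add: e_def sum_subtractf)
  moreover have "0 \<le> sum e ?A"
    by (rule sum_nonneg) auto
  ultimately show "1/2 * (\<Sum>y\<in>\<Omega>. \<bar>p y - 1 / real (card \<Omega>)\<bar>) = \<bar>sum p ?A - real (card ?A) / real (card \<Omega>)\<bar>"
    by (simp add: e_def)
qed

lemma dg_tv_eq:
  assumes "x \<in> tables n q r c" "q > 0" "n \<ge> 2"
  shows "dg_tv n q r c t x
    = 1/2 * (\<Sum>y\<in>tables n q r c. \<bar>dg_H n q r c t x y - 1 / real (card (tables n q r c))\<bar>)"
proof -
  let ?\<Omega> = "tables n q r c"
  let ?F = "\<lambda>A. \<bar>(\<Sum>y\<in>A. dg_H n q r c t x y) - real (card A) / real (card ?\<Omega>)\<bar>"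
  have ne: "?\<Omega> \<noteq> {}" using assms by blast
  have img: "{?F A | A. A \<subseteq> ?\<Omega>} = ?F ` Pow ?\<Omega>" by auto
  obtain A where A: "A \<subseteq> ?\<Omega>"
    "1/2 * (\<Sum>y\<in>?\<Omega>. \<bar>dg_H n q r c t x y - 1 / real (card ?\<Omega>)\<bar>) = ?F A"
    by (rule half_l1_le_abs_sum[OF finite_tables sum_dg_H[OF assms] ne])
  show ?thesis
    unfolding dg_tv_def img
  proof (rule Max_eqI)
    show "finite (?F ` Pow ?\<Omega>)"
      using finite_tables by blast
    show "1/2 * (\<Sum>y\<in>?\<Omega>. \<bar>dg_H n q r c t x y - 1 / real (card ?\<Omega>)\<bar>) \<in> ?F ` Pow ?\<Omega>"
      using A by blast
  qed (use abs_sum_diff_uniform_le[OF finite_tables _ sum_dg_H[OF assms] ne] in auto)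
qed

lemma dg_tv_le:
  assumes "x \<in> tables n q r c" "q > 0" "n \<ge> 2"
  shows "dg_tv n q r c t x \<le> 1/2 * sqrt (\<Sum>\<xi>\<in>duals n q - {dual0 n}. exp (- 2 * t * gap n q \<xi>))"
proof -
  let ?\<Omega> = "tables n q r c"
  let ?N = "real (card ?\<Omega>)" and ?H = "dg_H n q r c t x"
  have N: "?N > 0"
    using assms(1) finite_tables card_gt_0_iff by fastforce
  have "(\<Sum>y\<in>?\<Omega>. \<bar>?H y - 1 / ?N\<bar> * 1)\<^sup>2 \<le> (\<Sum>y\<in>?\<Omega>. \<bar>?H y - 1 / ?N\<bar>\<^sup>2) * (\<Sum>y\<in>?\<Omega>. 1\<^sup>2)"
    by (rule Cauchy_Schwarz_ineq_sum)
  also have "\<dots> = ?N * ((\<Sum>y\<in>?\<Omega>. (?H y)\<^sup>2) - 2 / ?N * (\<Sum>y\<in>?\<Omega>. ?H y) + ?N * (1 / ?N)\<^sup>2)"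
    by (simp add: power2_diff sum.distrib sum_subtractf sum_distrib_left mult_ac)
  also have "\<dots> = (\<Sum>\<xi>\<in>duals n q. exp (- 2 * t * gap n q \<xi>)) - 1"
    using N by (simp only: sum_dg_H_squared[OF assms] sum_dg_H[OF assms]) (simp add: field_simps power2_eq_square)
  also have "\<dots> = (\<Sum>\<xi>\<in>duals n q - {dual0 n}. exp (- 2 * t * gap n q \<xi>))"
    using sum.remove[OF finite_duals dual0_in_duals[OF assms(2)], of "\<lambda>\<xi>. exp (- 2 * t * gap n q \<xi>)"]
    by (simp add: gap_dual0)
  finally have "(\<Sum>y\<in>?\<Omega>. \<bar>?H y - 1 / ?N\<bar>) \<le> sqrt (\<Sum>\<xi>\<in>duals n q - {dual0 n}. exp (- 2 * t * gap n q \<xi>))"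
    by (intro real_le_rsqrt) simp
  then show ?thesis
    by (simp add: dg_tv_eq[OF assms])
qed

section \<open>The lower bound on the mixing time\<close>

lemma dg_d_le:
  assumes "tables n q r c \<noteq> {}" "q > 0" "n \<ge> 2"
  shows "dg_d n q r c t \<le> 1/2 * sqrt (\<Sum>\<xi>\<in>duals n q - {dual0 n}. exp (- 2 * t * gap n q \<xi>))"
  unfolding dg_d_def using assms finite_tables dg_tv_le[OF _ assms(2,3)]
  by (intro Max.boundedI) auto

lemma dg_tv_le_dg_d: "x \<in> tables n q r c \<Longrightarrow> dg_tv n q r c t x \<le> dg_d n q r c t"
  unfolding dg_d_def by (intro Max_ge) (auto simp: finite_tables)

text \<open>Makes the set in the definition of the mixing time nonempty; the infimum of an empty set
  of reals would carry no information.\<close>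

lemma exists_time_dg_d_le:
  assumes "tables n q r c \<noteq> {}" "q > 0" "n \<ge> 2" "\<epsilon> > 0"
  shows "\<exists>t\<ge>0. dg_d n q r c t \<le> \<epsilon>"
proof -
  have "((\<lambda>t. exp (- 2 * t * gap n q \<xi>)) \<longlongrightarrow> 0) at_top" if "\<xi> \<in> duals n q - {dual0 n}" for \<xi>
  proof -
    have "gap n q \<xi> > 0"
      using gap_dual_pos[OF _ _ assms(2,3)] that by auto
    then have "filterlim (\<lambda>t. - (t * (2 * gap n q \<xi>))) at_bot at_top"
      by (intro filterlim_uminus_at_bot_at_top[THEN filterlim_compose]
            filterlim_at_top_mult_tendsto_pos[OF tendsto_const] filterlim_ident) (auto simp: mult.commute)
    then show ?thesis
      using exp_at_bot filterlim_compose by (force simp: mult_ac)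
  qed
  then have "((\<lambda>t. 1/2 * sqrt (\<Sum>\<xi>\<in>duals n q - {dual0 n}. exp (- 2 * t * gap n q \<xi>))) \<longlongrightarrow> 1/2 * sqrt (\<Sum>\<xi>\<in>duals n q - {dual0 n}. 0)) at_top"
    by (intro tendsto_intros)
  then have "\<forall>\<^sub>F t in at_top. 1/2 * sqrt (\<Sum>\<xi>\<in>duals n q - {dual0 n}. exp (- 2 * t * gap n q \<xi>)) < \<epsilon>"
    by (rule order_tendstoD) (use assms(4) in simp)
  then have "\<forall>\<^sub>F t in at_top. t \<ge> 0 \<and> 1/2 * sqrt (\<Sum>\<xi>\<in>duals n q - {dual0 n}. exp (- 2 * t * gap n q \<xi>)) < \<epsilon>"
    by (intro eventually_conj eventually_ge_at_top)
  then obtain t where "t \<ge> 0" "1/2 * sqrt (\<Sum>\<xi>\<in>duals n q - {dual0 n}. exp (- 2 * t * gap n q \<xi>)) < \<epsilon>"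
    by (auto simp: eventually_at_top_linorder)
  then show ?thesis
    using dg_d_le[OF assms(1-3), of t] by (intro exI[of _ t]) linarith
qed

section \<open>Gaps of single-cell characters and of their differences\<close>

definition cell :: "nat \<times> nat \<Rightarrow> nat \<Rightarrow> nat \<Rightarrow> int" where
  "cell p a b = of_bool (a = fst p) * of_bool (b = snd p)"

lemma minor_cell:
  "minor (cell p) i i' j j' =
    (of_bool (i = fst p) - of_bool (i' = fst p)) * (of_bool (j = snd p) - of_bool (j' = snd p))"
  by (simp add: minor_def cell_def algebra_simps)

lemma minor_diff:
  "minor (\<lambda>a b. \<xi> a b - \<zeta> a b) i i' j j' = minor \<xi> i i' j j' - minor \<zeta> i i' j j'"
  by (simp add: minor_def)

lemma osc_eq_sin: "osc q k = 2 * sin (pi * real_of_int k / real q) ^ 2"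
  using cos_double_sin[of "pi * real_of_int k / real q"] by (simp add: osc_def mult_ac)

lemma osc_1_le: "osc q 1 \<le> 2 * pi ^ 2 / real q ^ 2"
proof -
  have "sin (pi / real q) ^ 2 \<le> (pi / real q) ^ 2"
    using abs_sin_x_le_abs_x[of "pi / real q"] by (simp only: abs_le_square_iff)
  then show ?thesis
    by (simp add: osc_eq_sin power_divide)
qed

lemma osc_1_pos:
  assumes "q \<ge> 2"
  shows "osc q 1 > 0"
proof -
  have "0 < sin (pi / real q)"
    using assms by (intro sin_gt_zero) (auto simp: field_simps)
  then show ?thesis by (simp add: osc_eq_sin)
qed

text \<open>With c = cos (2 pi / q) the difference of the two sides is 2 c (1 - c). The bound on
  \<open>q\<close> is what makes c nonnegative.\<close>

lemma osc_2_ge: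
  assumes "q \<ge> 4"
  shows "osc q 2 \<ge> 2 * osc q 1"
proof -
  have "2 * pi / real q \<le> pi / 2"
    using assms by (simp add: field_simps)
  then have "0 \<le> cos (2 * pi / real q)"
    by (intro cos_ge_zero) (auto intro: order_trans[of _ 0])
  moreover have "cos (2 * pi / real q) \<le> 1" by simp
  ultimately have "cos (2 * pi / real q) * (1 - cos (2 * pi / real q)) \<ge> 0"
    by (intro mult_nonneg_nonneg) auto
  moreover have "osc q 2 = 2 - 2 * cos (2 * pi / real q) ^ 2"
    using cos_double_cos[of "2 * pi / real q"] by (simp add: osc_def mult_ac)
  ultimately show ?thesis
    by (simp add: osc_def power2_eq_square algebra_simps)
qed

text \<open>The right-hand side is polynomial so that for single cells, whose minors are products of a row factor
  and a column factor, its sum over all minors factorises.\<close>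

lemma osc_diff_ge:
  assumes "q \<ge> 4" "D \<in> {-1, 0, 1}" "D' \<in> {-1, 0, 1::int}"
  shows "osc q (D - D') \<ge> osc q 1 * real_of_int (D ^ 2 + D' ^ 2 - D * D' - D ^ 2 * D' ^ 2)"
  \<comment> \<open>The polynomial is 0 for equal arguments, 1 if exactly one of them vanishes and 2
    for opposite signs; the last case is the one that needs the bound on
    \<open>osc q 2\<close>.\<close>
  using assms(2,3) osc_2_ge[OF assms(1)] osc_minus[of q 1] osc_minus[of q 2] by auto

lemma sum_bool_diff_mult:
  assumes "k < n" "k' < n"
  shows "(\<Sum>i<n. \<Sum>i'<n. (of_bool (i = k) - of_bool (i' = k)) * (of_bool (i = k') - of_bool (i' = k')))
     = 2 * real n * of_bool (k = k') - 2"
proof -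
  have s: "(\<Sum>i<n. of_bool (i = k) * c i) = c k" if "k < n" for k and c :: "nat \<Rightarrow> real"
    using that by (simp add: of_bool_def if_distrib[where f = "\<lambda>u. u * _"] cong: if_cong)
  have "(\<Sum>i<n. \<Sum>i'<n. (of_bool (i = k) - of_bool (i' = k)) * (of_bool (i = k') - of_bool (i' = k')))
     = (\<Sum>i<n. \<Sum>i'<n. of_bool (i = k) * of_bool (i = k') - of_bool (i = k) * of_bool (i' = k')
         - of_bool (i = k') * of_bool (i' = k) + of_bool (i' = k) * (of_bool (i' = k') :: real))"
    by (intro sum.cong refl) (simp add: algebra_simps)
  also have "\<dots> = 2 * real n * of_bool (k = k') - 2"
    using assms s[of k "\<lambda>i. 1"] s[of k' "\<lambda>i. 1"]
    by (simp add: sum.distrib sum_subtractf sum_distrib_left[symmetric] sum_distrib_right[symmetric] s)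
  finally show ?thesis .
qed

lemma sum_quad_prod:
  fixes f g :: "nat \<Rightarrow> nat \<Rightarrow> real"
  shows "(\<Sum>i<n. \<Sum>i'<n. \<Sum>j<n. \<Sum>j'<n. f i i' * g j j') = (\<Sum>i<n. \<Sum>i'<n. f i i') * (\<Sum>j<n. \<Sum>j'<n. g j j')"
  by (simp only: sum_distrib_left[symmetric] sum_distrib_right[symmetric])

lemma sum_minor_cell_mult:
  assumes "p \<in> {..<n} \<times> {..<n}" "p' \<in> {..<n} \<times> {..<n}"
  shows "(\<Sum>i<n. \<Sum>i'<n. \<Sum>j<n. \<Sum>j'<n. real_of_int (minor (cell p) i i' j j' * minor (cell p') i i' j j'))
    = (2 * real n * of_bool (fst p = fst p') - 2) * (2 * real n * of_bool (snd p = snd p') - 2)"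
proof -
  have "(\<Sum>i<n. \<Sum>i'<n. \<Sum>j<n. \<Sum>j'<n. real_of_int (minor (cell p) i i' j j' * minor (cell p') i i' j j'))
     = (\<Sum>i<n. \<Sum>i'<n. \<Sum>j<n. \<Sum>j'<n.
         ((of_bool (i = fst p) - of_bool (i' = fst p)) * (of_bool (i = fst p') - of_bool (i' = fst p')))
         * ((of_bool (j = snd p) - of_bool (j' = snd p)) * (of_bool (j = snd p') - of_bool (j' = snd p'))))"
    by (simp add: minor_cell mult_ac)
  also have "\<dots> = (2 * real n * of_bool (fst p = fst p') - 2) * (2 * real n * of_bool (snd p = snd p') - 2)"
    using assms by (subst sum_quad_prod) (auto simp: sum_bool_diff_mult)
  finally show ?thesis .
qed

text \<open>For equal indices the product of two indicator differences is already a square; for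
  distinct ones it is nonzero only at the two index pairs made of both, where it is -1. So squaring
  only multiplies by a sign \<sigma>. Distinct cells in a common row or column then give 0, and all
  other distinct cells give exactly 8.\<close>

lemma sum_minor_cell_sq_mult_le:
  assumes "p \<in> {..<n} \<times> {..<n}" "p' \<in> {..<n} \<times> {..<n}" "p \<noteq> p'"
  shows "(\<Sum>i<n. \<Sum>i'<n. \<Sum>j<n. \<Sum>j'<n. real_of_int (minor (cell p) i i' j j' * minor (cell p') i i' j j'
      + minor (cell p) i i' j j' ^ 2 * minor (cell p') i i' j j' ^ 2)) \<le> 8"
proof -
  define \<sigma> :: "nat \<Rightarrow> nat \<Rightarrow> int" where "\<sigma> k k' = (if k = k' then 1 else - 1)" for k k'
  have sq: "((of_bool (i = k) - of_bool (i' = k)) ^ 2 * (of_bool (i = k') - of_bool (i' = k')) ^ 2 :: int)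
      = \<sigma> k k' * ((of_bool (i = k) - of_bool (i' = k)) * (of_bool (i = k') - of_bool (i' = k')))" for i i' k k' :: nat
    by (auto simp: \<sigma>_def)
  have "minor (cell p) i i' j j' ^ 2 * minor (cell p') i i' j j' ^ 2
      = \<sigma> (fst p) (fst p') * \<sigma> (snd p) (snd p') * (minor (cell p) i i' j j' * minor (cell p') i i' j j')" for i i' j j'
    using sq[of i "fst p" i' "fst p'"] sq[of j "snd p" j' "snd p'"]
    by (simp add: minor_cell power_mult_distrib mult_ac)
  then have "(\<Sum>i<n. \<Sum>i'<n. \<Sum>j<n. \<Sum>j'<n. real_of_int (minor (cell p) i i' j j' * minor (cell p') i i' j j'
      + minor (cell p) i i' j j' ^ 2 * minor (cell p') i i' j j' ^ 2))
    = (\<Sum>i<n. \<Sum>i'<n. \<Sum>j<n. \<Sum>j'<n. (1 + real_of_int (\<sigma> (fst p) (fst p') * \<sigma> (snd p) (snd p'))) *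
        real_of_int (minor (cell p) i i' j j' * minor (cell p') i i' j j'))"
    by (simp add: algebra_simps)
  also have "\<dots> = (1 + real_of_int (\<sigma> (fst p) (fst p') * \<sigma> (snd p) (snd p'))) *
      ((2 * real n * of_bool (fst p = fst p') - 2) * (2 * real n * of_bool (snd p = snd p') - 2))"
    by (simp only: sum_distrib_left[symmetric] sum_minor_cell_mult[OF assms(1,2)])
  also have "\<dots> \<le> 8"
    using assms(3) by (auto simp: \<sigma>_def prod_eq_iff)
  finally show ?thesis .
qed

lemma gap_cell:
  assumes "p \<in> {..<n} \<times> {..<n}" "n \<ge> 2"
  shows "gap n q (cell p) = 4 * osc q 1 / real n ^ 2"
proof -
  have "osc q (minor (cell p) i i' j j') = osc q 1 * real_of_int (minor (cell p) i i' j j' * minor (cell p) i i' j j')"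
    for i i' j j'
    using osc_minus[of q 1] by (auto simp: minor_cell)
  then have "gap n q (cell p) = osc q 1 * ((2 * real n - 2) * (2 * real n - 2)) / (real n ^ 2 * (real n - 1) ^ 2)"
    unfolding gap_def by (simp only: sum_distrib_left[symmetric] sum_minor_cell_mult[OF assms(1,1)]) simp
  also have "(2 * real n - 2) * (2 * real n - 2) = 4 * (real n - 1) ^ 2"
    by (simp add: power2_eq_square algebra_simps)
  finally show ?thesis
    using assms(2) by simp
qed

text \<open>Near additivity: the first term is the sum of the two single-cell gaps, and the defect
  is smaller by the factor (n - 1)^2. This makes distinct cells almost uncorrelated under the
  walk.\<close>

lemma gap_cell_diff_ge:
  assumes "p \<in> {..<n} \<times> {..<n}" "p' \<in> {..<n} \<times> {..<n}" "p \<noteq> p'" "n \<ge> 2" "q \<ge> 4"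
  shows "gap n q (\<lambda>a b. cell p a b - cell p' a b)
    \<ge> 8 * osc q 1 / real n ^ 2 - 8 * osc q 1 / (real n ^ 2 * (real n - 1) ^ 2)"
proof -
  let ?m = "\<lambda>p i i' j j'. minor (cell p) i i' j j'"
  have mem: "?m p i i' j j' \<in> {-1, 0, 1}" for p i i' j j'
    by (auto simp: minor_cell)
  have "osc q 1 * (8 * (real n - 1) ^ 2 - 8)
      \<le> osc q 1 * ((\<Sum>i<n. \<Sum>i'<n. \<Sum>j<n. \<Sum>j'<n. real_of_int (?m p i i' j j' * ?m p i i' j j'))
       + (\<Sum>i<n. \<Sum>i'<n. \<Sum>j<n. \<Sum>j'<n. real_of_int (?m p' i i' j j' * ?m p' i i' j j'))
       - (\<Sum>i<n. \<Sum>i'<n. \<Sum>j<n. \<Sum>j'<n. real_of_int (?m p i i' j j' * ?m p' i i' j j' + ?m p i i' j j' ^ 2 * ?m p' i i' j j' ^ 2)))"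
    using sum_minor_cell_sq_mult_le[OF assms(1-3)] osc_nonneg
    unfolding sum_minor_cell_mult[OF assms(1,1)] sum_minor_cell_mult[OF assms(2,2)]
    by (intro mult_left_mono) (auto simp: power2_eq_square algebra_simps)
  also have "\<dots> = (\<Sum>i<n. \<Sum>i'<n. \<Sum>j<n. \<Sum>j'<n. osc q 1 *
      real_of_int (?m p i i' j j' ^ 2 + ?m p' i i' j j' ^ 2 - ?m p i i' j j' * ?m p' i i' j j' - ?m p i i' j j' ^ 2 * ?m p' i i' j j' ^ 2))"
    unfolding sum_distrib_left[symmetric] sum.distrib[symmetric] sum_subtractf[symmetric]
    by (intro arg_cong[where f = "\<lambda>u. osc q 1 * u"] sum.cong refl) (simp add: power2_eq_square)
  also have "\<dots> \<le> (\<Sum>i<n. \<Sum>i'<n. \<Sum>j<n. \<Sum>j'<n. osc q (minor (\<lambda>a b. cell p a b - cell p' a b) i i' j j'))"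
    unfolding minor_diff by (intro sum_mono osc_diff_ge mem assms(5))
  finally have "osc q 1 * (8 * (real n - 1) ^ 2 - 8) / (real n ^ 2 * (real n - 1) ^ 2) \<le> gap n q (\<lambda>a b. cell p a b - cell p' a b)"
    unfolding gap_def by (intro divide_right_mono) auto
  then show ?thesis
    using assms(4) by (simp add: field_simps)
qed

text \<open>The centring by half of the mean difference is what produces the term \<open>- M\<^sup>2 / 2\<close>.\<close>

lemma second_moment_l1_bound:
  fixes p h :: "'a \<Rightarrow> real"
  assumes "finite \<Omega>" "\<Omega> \<noteq> {}" "\<And>y. y \<in> \<Omega> \<Longrightarrow> 0 \<le> p y" "sum p \<Omega> = 1"
    and M: "(\<Sum>y\<in>\<Omega>. p y * h y) = M" and h0: "sum h \<Omega> = 0"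
  shows "M ^ 2 \<le> ((\<Sum>y\<in>\<Omega>. p y * h y ^ 2) + (\<Sum>y\<in>\<Omega>. h y ^ 2) / real (card \<Omega>) - M ^ 2 / 2)
    * (\<Sum>y\<in>\<Omega>. \<bar>p y - 1 / real (card \<Omega>)\<bar>)"
proof -
  define N where "N = real (card \<Omega>)"
  have N: "N > 0" using assms(1,2) by (simp add: N_def card_gt_0_iff)
  define e where "e y = p y - 1 / N" for y
  define g where "g y = h y - M / 2" for y
  have "(\<Sum>y\<in>\<Omega>. g y * e y) = (\<Sum>y\<in>\<Omega>. p y * h y) - sum h \<Omega> / N - M / 2 * (sum p \<Omega> - 1 / N * N)"
    by (simp add: g_def e_def algebra_simps sum.distrib sum_subtractf sum_distrib_left sum_divide_distrib N_def)
  then have "M = (\<Sum>y\<in>\<Omega>. g y * e y)"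
    using N by (simp add: M h0 assms(4))
  \<comment> \<open>Splitting off the root of the deviation makes the Cauchy-Schwarz inequality
    below produce one factor that is the l1 distance and one that is a second moment of
    \<open>g\<close> under the sum of both measures, since the deviation is at most
    \<open>p y + 1 / N\<close>.\<close>
  also have "\<dots> \<le> (\<Sum>y\<in>\<Omega>. (\<bar>g y\<bar> * sqrt \<bar>e y\<bar>) * sqrt \<bar>e y\<bar>)"
    by (intro sum_mono) (simp add: mult.assoc abs_mult[symmetric] abs_ge_self)
  finally have M_le: "M \<le> (\<Sum>y\<in>\<Omega>. (\<bar>g y\<bar> * sqrt \<bar>e y\<bar>) * sqrt \<bar>e y\<bar>)" .
  have "- M = (\<Sum>y\<in>\<Omega>. - (g y * e y))"
    using \<open>M = (\<Sum>y\<in>\<Omega>. g y * e y)\<close> by (simp add: sum_negf)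
  also have "\<dots> \<le> (\<Sum>y\<in>\<Omega>. (\<bar>g y\<bar> * sqrt \<bar>e y\<bar>) * sqrt \<bar>e y\<bar>)"
    by (intro sum_mono) (simp add: mult.assoc abs_mult[symmetric] abs_ge_minus_self)
  finally have "M ^ 2 \<le> (\<Sum>y\<in>\<Omega>. (\<bar>g y\<bar> * sqrt \<bar>e y\<bar>) * sqrt \<bar>e y\<bar>) ^ 2"
    using M_le by (intro power2_le_iff_abs_le[THEN iffD2]) auto
  also have "\<dots> \<le> (\<Sum>y\<in>\<Omega>. (\<bar>g y\<bar> * sqrt \<bar>e y\<bar>) ^ 2) * (\<Sum>y\<in>\<Omega>. sqrt \<bar>e y\<bar> ^ 2)"
    by (rule Cauchy_Schwarz_ineq_sum)
  also have "\<dots> = (\<Sum>y\<in>\<Omega>. g y ^ 2 * \<bar>e y\<bar>) * (\<Sum>y\<in>\<Omega>. \<bar>e y\<bar>)"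
    by (simp add: power_mult_distrib)
  also have "\<dots> \<le> (\<Sum>y\<in>\<Omega>. g y ^ 2 * (p y + 1 / N)) * (\<Sum>y\<in>\<Omega>. \<bar>e y\<bar>)"
  proof (intro mult_right_mono sum_mono mult_left_mono)
    fix y assume "y \<in> \<Omega>"
    then show "\<bar>e y\<bar> \<le> p y + 1 / N"
      using assms(3)[of y] N by (simp add: e_def abs_le_iff)
  qed (auto intro: sum_nonneg)
  also have "(\<Sum>y\<in>\<Omega>. g y ^ 2 * (p y + 1 / N)) =
      (\<Sum>y\<in>\<Omega>. p y * h y ^ 2 + h y ^ 2 / N - M * (p y * h y) - M * h y / N + M ^ 2 / 4 * p y + M ^ 2 / 4 / N)"
    by (intro sum.cong refl) (simp add: g_def power2_eq_square algebra_simps add_divide_distrib diff_divide_distrib)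
  also have "\<dots> = (\<Sum>y\<in>\<Omega>. p y * h y ^ 2) + (\<Sum>y\<in>\<Omega>. h y ^ 2) / N - M * (\<Sum>y\<in>\<Omega>. p y * h y)
        - M * sum h \<Omega> / N + M ^ 2 / 4 * sum p \<Omega> + N * (M ^ 2 / 4 / N)"
    by (simp add: sum.distrib sum_subtractf sum_distrib_left sum_divide_distrib N_def)
  also have "\<dots> = (\<Sum>y\<in>\<Omega>. p y * h y ^ 2) + (\<Sum>y\<in>\<Omega>. h y ^ 2) / N - M ^ 2 / 2"
    using N by (simp add: M h0 assms(4) power2_eq_square)
  finally show ?thesis
    by (simp add: e_def N_def)
qed

text \<open>Expanding the square directly would also bring in sums of two phases. Adding the squared
  sum of sines cancels them, so only differences of cells need a gap estimate.\<close>

lemma sum_cos_squared_le: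
  fixes u :: "'a \<Rightarrow> real"
  shows "(\<Sum>p\<in>A. cos (u p)) ^ 2 \<le> (\<Sum>p\<in>A. \<Sum>p'\<in>A. cos (u p - u p'))"
proof -
  have "(\<Sum>p\<in>A. \<Sum>p'\<in>A. cos (u p - u p')) = (\<Sum>p\<in>A. cos (u p)) ^ 2 + (\<Sum>p\<in>A. sin (u p)) ^ 2"
    by (simp add: cos_diff sum.distrib power2_eq_square sum_product)
  then show ?thesis by simp
qed

text \<open>Every phase is centred at its value at \<open>x\<close>, so all cosines start at 1 and
  decay by the same factor \<rho>; their sum has mean n^2 \<rho>. The number \<delta> is
  \<open>t\<close> times the defect in the additivity of the gaps. The diagonal terms account for
  n^2 under each of the two measures.\<close>

lemma dg_tv_second_moment:
  fixes t :: real
  assumes x: "x \<in> tables n q r c" and q: "q \<ge> 4" and n: "n \<ge> 3" and t: "t \<ge> 0"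
  defines "\<rho> \<equiv> exp (- t * (4 * osc q 1 / real n ^ 2))"
    and "\<delta> \<equiv> t * (8 * osc q 1 / (real n ^ 2 * (real n - 1) ^ 2))"
  shows "(real n ^ 2 * \<rho>) ^ 2 \<le> (2 * real n ^ 2 + (real n ^ 2 * \<rho>) ^ 2 * (exp \<delta> - 1/2)) * (2 * dg_tv n q r c t x)"
proof -
  let ?\<Omega> = "tables n q r c" and ?C = "{..<n} \<times> {..<n}" and ?H = "dg_H n q r c t x"
  let ?N = "real (card ?\<Omega>)"
  have q0: "q > 0" and n2: "n \<ge> 2" using q n by auto
  define u where "u y p = phase n q (cell p) y - phase n q (cell p) x" for y p
  define h where "h y = (\<Sum>p\<in>?C. cos (u y p))" for y
  define \<zeta> where "\<zeta> p p' = (\<lambda>a b. cell p a b - cell p' a b)" for p p'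
  have card_C: "real (card ?C) = real n ^ 2"
    by (simp add: power2_eq_square)
  have M: "(\<Sum>y\<in>?\<Omega>. ?H y * h y) = real n ^ 2 * \<rho>"
  proof -
    have "(\<Sum>y\<in>?\<Omega>. ?H y * h y) = (\<Sum>p\<in>?C. \<Sum>y\<in>?\<Omega>. ?H y * cos (phase n q (cell p) y - phase n q (cell p) x))"
      unfolding h_def u_def sum_distrib_left by (rule sum.swap)
    also have "\<dots> = (\<Sum>p\<in>?C. \<rho>)"
      by (intro sum.cong refl) (simp add: dg_H_eigen[OF x q0 n2] gap_cell[OF _ n2] \<rho>_def)
    finally show ?thesis by (simp only: sum_constant card_C)
  qed
  have g1: "gap n q (cell p) \<noteq> 0" if "p \<in> ?C" for p
    using gap_cell[OF that n2, of q] osc_1_pos[of q] q n by simp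
  have h0: "sum h ?\<Omega> = 0"
  proof -
    have "sum h ?\<Omega> = (\<Sum>p\<in>?C. \<Sum>y\<in>?\<Omega>. cos (phase n q (cell p) y - phase n q (cell p) x))"
      unfolding h_def u_def by (rule sum.swap)
    also have "\<dots> = 0"
      by (intro sum.neutral ballI sum_tables_cos g1 q0 n2)
    finally show ?thesis .
  qed
  have ph: "u y p - u y p' = phase n q (\<zeta> p p') y - phase n q (\<zeta> p p') x" for y p p'
    by (simp add: u_def \<zeta>_def phase_def left_diff_distrib sum_subtractf right_diff_distrib diff_divide_distrib)
  have g2: "gap n q (\<zeta> p p') \<ge> 2 * (4 * osc q 1 / real n ^ 2) - 8 * osc q 1 / (real n ^ 2 * (real n - 1) ^ 2)"
    if "p \<in> ?C" "p' \<in> ?C" "p \<noteq> p'" for p p'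
    using gap_cell_diff_ge[OF that n2 q] by (simp add: \<zeta>_def)
  \<comment> \<open>Here \<open>n \<ge> 3\<close> enters: it makes the defect strictly smaller than
    the main term.\<close>
  have g2_pos: "gap n q (\<zeta> p p') \<noteq> 0" if "p \<in> ?C" "p' \<in> ?C" "p \<noteq> p'" for p p'
  proof -
    have "1 < (real n - 1) ^ 2"
      using n by (intro one_less_power) auto
    then have "8 * osc q 1 / (real n ^ 2 * (real n - 1) ^ 2) < 8 * osc q 1 / (real n ^ 2)"
      using osc_1_pos[of q] q n by (intro divide_strict_left_mono) auto
    then show ?thesis using g2[OF that] by simp
  qed
  have second: "(\<Sum>y\<in>?\<Omega>. ?H y * h y ^ 2) \<le> real n ^ 2 + (real n ^ 2 * \<rho>) ^ 2 * exp \<delta>"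
  proof -
    have "(\<Sum>y\<in>?\<Omega>. ?H y * h y ^ 2) \<le> (\<Sum>y\<in>?\<Omega>. ?H y * (\<Sum>p\<in>?C. \<Sum>p'\<in>?C. cos (u y p - u y p')))"
      unfolding h_def by (intro sum_mono mult_left_mono sum_cos_squared_le dg_H_nonneg x q0 n2 t)
    also have "\<dots> = (\<Sum>p\<in>?C. \<Sum>p'\<in>?C. \<Sum>y\<in>?\<Omega>. ?H y * cos (phase n q (\<zeta> p p') y - phase n q (\<zeta> p p') x))"
      unfolding sum_distrib_left ph
      by (subst sum.swap) (intro sum.cong refl sum.swap)
    also have "\<dots> = (\<Sum>p\<in>?C. \<Sum>p'\<in>?C. exp (- t * gap n q (\<zeta> p p')))"
      by (simp add: dg_H_eigen[OF x q0 n2])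
    also have "\<dots> \<le> (\<Sum>p\<in>?C. \<Sum>p'\<in>?C. (if p = p' then 1 else 0) + \<rho> ^ 2 * exp \<delta>)"
    proof (intro sum_mono)
      fix p p' assume pp: "p \<in> ?C" "p' \<in> ?C"
      show "exp (- t * gap n q (\<zeta> p p')) \<le> (if p = p' then 1 else 0) + \<rho> ^ 2 * exp \<delta>"
      proof (cases "p = p'")
        case True
        have "exp (- t * gap n q (\<zeta> p p')) \<le> 1"
          using t gap_nonneg[of n q "\<zeta> p p'"] by simp
        with True show ?thesis by (simp add: add_increasing2)
      next
        case False
        have "exp (- t * gap n q (\<zeta> p p')) \<le> exp (2 * (- t * (4 * osc q 1 / real n ^ 2)) + \<delta>)"
          using mult_left_mono[OF g2[OF pp False] t] unfolding exp_le_cancel_iff \<delta>_def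
          by (simp add: right_diff_distrib)
        also have "\<dots> = \<rho> ^ 2 * exp \<delta>"
          by (simp add: \<rho>_def exp_add power2_eq_square flip: exp_add)
        finally show ?thesis using False by simp
      qed
    qed
    also have "\<dots> = real n ^ 2 + (real n ^ 2 * \<rho>) ^ 2 * exp \<delta>"
      by (simp add: sum.distrib card_C power_mult_distrib) (simp add: power2_eq_square power4_eq_xxxx algebra_simps)
    finally show ?thesis .
  qed
  have N: "?N > 0"
    using x finite_tables card_gt_0_iff by fastforce
  have unif: "(\<Sum>y\<in>?\<Omega>. h y ^ 2) / ?N \<le> real n ^ 2"
  proof -
    have "(\<Sum>y\<in>?\<Omega>. h y ^ 2) \<le> (\<Sum>y\<in>?\<Omega>. \<Sum>p\<in>?C. \<Sum>p'\<in>?C. cos (u y p - u y p'))"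
      unfolding h_def by (intro sum_mono sum_cos_squared_le)
    also have "\<dots> = (\<Sum>p\<in>?C. \<Sum>p'\<in>?C. \<Sum>y\<in>?\<Omega>. cos (phase n q (\<zeta> p p') y - phase n q (\<zeta> p p') x))"
      unfolding ph by (subst sum.swap) (intro sum.cong refl sum.swap)
    also have "\<dots> = (\<Sum>p\<in>?C. \<Sum>p'\<in>?C. if p = p' then ?N else 0)"
    proof (intro sum.cong refl)
      fix p p' assume pp: "p \<in> ?C" "p' \<in> ?C"
      show "(\<Sum>y\<in>?\<Omega>. cos (phase n q (\<zeta> p p') y - phase n q (\<zeta> p p') x)) = (if p = p' then ?N else 0)"
        using sum_tables_cos[OF g2_pos[OF pp] q0 n2] by (auto simp: \<zeta>_def phase_def)
    qed
    also have "\<dots> = real n ^ 2 * ?N"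
      by (simp add: power2_eq_square)
    finally show ?thesis using N by (simp add: field_simps)
  qed
  have "(real n ^ 2 * \<rho>) ^ 2 \<le> ((\<Sum>y\<in>?\<Omega>. ?H y * h y ^ 2) + (\<Sum>y\<in>?\<Omega>. h y ^ 2) / ?N - (real n ^ 2 * \<rho>) ^ 2 / 2)
     * (\<Sum>y\<in>?\<Omega>. \<bar>?H y - 1 / ?N\<bar>)"
    by (rule second_moment_l1_bound[OF finite_tables _ _ sum_dg_H[OF x q0 n2] M h0])
       (use x dg_H_nonneg[OF x _ q0 n2 t] in auto)
  also have "\<dots> \<le> (2 * real n ^ 2 + (real n ^ 2 * \<rho>) ^ 2 * (exp \<delta> - 1/2)) * (\<Sum>y\<in>?\<Omega>. \<bar>?H y - 1 / ?N\<bar>)"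
    using second unif by (intro mult_right_mono sum_nonneg) (auto simp: algebra_simps)
  finally show ?thesis
    by (simp add: dg_tv_eq[OF x q0 n2])
qed

text \<open>Let X be the squared mean divided by n^2. With \<delta> = 0 the second-moment bound
  would give (1 - \<epsilon>) X <= 4 \<epsilon>, whereas an earlier time gives (1 - \<epsilon>) X >=
  5 \<epsilon>; this is the 5 in the logarithm. The slack between 4 and 5 pays for \<delta>: the
  tolerance in \<open>small\<close> adds less than (1 - \<epsilon>) X / 5.\<close>

lemma time_ge_of_dg_tv_le:
  fixes \<epsilon> t :: real
  assumes x: "x \<in> tables n q r c" and q: "q \<ge> 4" and n: "n \<ge> 3" and t: "t \<ge> 0"
    and eps: "0 < \<epsilon>" "\<epsilon> < 1" and tv: "dg_tv n q r c t x \<le> \<epsilon>"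
  defines "L \<equiv> ln (real n) + ln (1 - 1 / real n) + 1/2 * ln ((inverse \<epsilon> - 1) / 5)"
  assumes small: "exp (2 * L / (real n - 1) ^ 2) - 1 < (1 - \<epsilon>) / (10 * \<epsilon>)"
  shows "real n ^ 2 * real q ^ 2 / (8 * pi ^ 2) * L \<le> t"
proof (rule ccontr)
  assume "\<not> ?thesis"
  then have lt: "t < real n ^ 2 * real q ^ 2 / (8 * pi ^ 2) * L" by simp
  define s where "s = t * (4 * osc q 1 / real n ^ 2)"
  define \<delta> where "\<delta> = t * (8 * osc q 1 / (real n ^ 2 * (real n - 1) ^ 2))"
  define X where "X = real n ^ 2 * exp (- s) ^ 2"
  have s_le: "s \<le> L"
  proof -
    have "s \<le> t * (4 * (2 * pi ^ 2 / real q ^ 2) / real n ^ 2)"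
      unfolding s_def using t osc_1_le by (intro mult_left_mono divide_right_mono) auto
    also have "\<dots> \<le> real n ^ 2 * real q ^ 2 / (8 * pi ^ 2) * L * (4 * (2 * pi ^ 2 / real q ^ 2) / real n ^ 2)"
      using lt by (intro mult_right_mono) auto
    also have "\<dots> = L" using n q by (simp add: field_simps)
    finally show ?thesis .
  qed
  have \<delta>_eq: "\<delta> = 2 * s / (real n - 1) ^ 2"
    by (simp add: \<delta>_def s_def)
  have \<delta>_le: "exp \<delta> - 1 < (1 - \<epsilon>) / (10 * \<epsilon>)"
  proof -
    have "\<delta> \<le> 2 * L / (real n - 1) ^ 2"
      unfolding \<delta>_eq using s_le by (intro divide_right_mono) auto
    then show ?thesis using small exp_le_cancel_iff[of \<delta> "2 * L / (real n - 1) ^ 2"] by linarith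
  qed
  have "exp (2 * L) = (real n * (1 - 1 / real n)) ^ 2 * ((inverse \<epsilon> - 1) / 5)"
  proof -
    have "1 < inverse \<epsilon>" using eps by (simp add: one_less_inverse)
    then have "exp (ln ((inverse \<epsilon> - 1) / 5)) = (inverse \<epsilon> - 1) / 5"
      by simp
    moreover have "2 * L = (ln (real n) + ln (1 - 1 / real n)) + (ln (real n) + ln (1 - 1 / real n)) + ln ((inverse \<epsilon> - 1) / 5)"
      by (simp add: L_def)
    moreover have "exp (ln (real n)) = real n" "exp (ln (1 - 1 / real n)) = 1 - 1 / real n"
      using n by auto
    ultimately show ?thesis
      by (simp only: exp_add) (simp add: power2_eq_square)
  qed
  also have "\<dots> \<le> real n ^ 2 * ((inverse \<epsilon> - 1) / 5)"
    using n eps by (intro mult_right_mono power_mono) (auto simp: one_le_inverse_iff field_simps)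
  finally have "exp (2 * L) \<le> real n ^ 2 * ((inverse \<epsilon> - 1) / 5)" .
  then have "5 * \<epsilon> * exp (2 * L) \<le> (1 - \<epsilon>) * real n ^ 2"
    using eps by (simp add: field_simps)
  moreover have "5 * \<epsilon> * exp (2 * s) \<le> 5 * \<epsilon> * exp (2 * L)"
    using eps s_le by simp
  moreover have "X = real n ^ 2 / exp (2 * s)"
    by (simp add: X_def exp_minus power_inverse divide_inverse exp_double)
  ultimately have "5 * \<epsilon> * exp (2 * s) \<le> ((1 - \<epsilon>) * X) * exp (2 * s)"
    by simp
  then have X_ge: "5 * \<epsilon> \<le> (1 - \<epsilon>) * X"
    by (rule mult_right_le_imp_le) simp
  have Xpos: "X > 0" using n by (simp add: X_def)
  have "(real n ^ 2 * exp (- s)) ^ 2 \<le> (2 * real n ^ 2 + (real n ^ 2 * exp (- s)) ^ 2 * (exp \<delta> - 1/2)) * (2 * dg_tv n q r c t x)"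
    using dg_tv_second_moment[OF x q n t] by (simp add: s_def \<delta>_def)
  also have "(real n ^ 2 * exp (- s)) ^ 2 = real n ^ 2 * X"
    by (simp add: X_def power_mult_distrib)
  finally have "real n ^ 2 * X \<le> real n ^ 2 * ((2 + X * (exp \<delta> - 1/2)) * (2 * dg_tv n q r c t x))"
    by (simp add: algebra_simps)
  then have "X \<le> (2 + X * (exp \<delta> - 1/2)) * (2 * dg_tv n q r c t x)"
    using n by simp
  also have "\<dots> \<le> (2 + X * (exp \<delta> - 1/2)) * (2 * \<epsilon>)"
  proof (rule mult_left_mono)
    have "1 \<le> exp \<delta>"
      using t by (simp add: \<delta>_def osc_nonneg)
    then have "0 \<le> X * (exp \<delta> - 1/2)"
      using Xpos by (intro mult_nonneg_nonneg) linarith+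
    then show "0 \<le> 2 + X * (exp \<delta> - 1/2)" by linarith
  qed (use tv in simp)
  also have "\<dots> = 4 * \<epsilon> + X * \<epsilon> + X * (2 * \<epsilon> * (exp \<delta> - 1))"
    by (simp add: algebra_simps)
  also have "\<dots> < 4 * \<epsilon> + X * \<epsilon> + X * ((1 - \<epsilon>) / 5)"
    using \<delta>_le eps Xpos by (intro add_strict_left_mono mult_strict_left_mono) (auto simp: field_simps)
  finally have "(1 - \<epsilon>) * X < 4 * \<epsilon> + (1 - \<epsilon>) * X / 5"
    by (simp add: algebra_simps)
  then show False
    using X_ge by linarith
qed

text \<open>The bracket grows only like ln n, so after division by (n - 1)^2 the tolerance on the
  defect is eventually met.\<close>

lemma dg_tmix_ge:
  fixes q :: "nat \<Rightarrow> nat" and r c :: "nat \<Rightarrow> nat \<Rightarrow> int"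
  assumes eps: "0 < \<epsilon>" "\<epsilon> < 1"
    and nonempty: "\<forall>\<^sub>F n in sequentially. tables n (q n) (r n) (c n) \<noteq> {}"
    and q: "filterlim q at_top sequentially"
  shows "\<forall>\<^sub>F n in sequentially. dg_tmix n (q n) (r n) (c n) \<epsilon> \<ge>
      real n ^ 2 * real (q n) ^ 2 / (8 * pi ^ 2) *
      (ln (real n) + ln (1 - 1 / real n) + 1/2 * ln ((inverse \<epsilon> - 1) / 5))"
proof -
  define \<kappa> where "\<kappa> = 1/2 * ln ((inverse \<epsilon> - 1) / 5)"
  have "(\<lambda>n. 2 * (ln (real n) + ln (1 - 1 / real n) + \<kappa>) / (real n - 1) ^ 2) \<longlonglongrightarrow> 0"
    by real_asymp
  then have "(\<lambda>n. exp (2 * (ln (real n) + ln (1 - 1 / real n) + \<kappa>) / (real n - 1) ^ 2) - 1) \<longlonglongrightarrow> exp 0 - 1"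
    by (intro tendsto_intros)
  then have small: "\<forall>\<^sub>F n in sequentially. exp (2 * (ln (real n) + ln (1 - 1 / real n) + \<kappa>) / (real n - 1) ^ 2) - 1 < (1 - \<epsilon>) / (10 * \<epsilon>)"
    by (rule order_tendstoD) (use eps in simp)
  have "\<forall>\<^sub>F n in sequentially. q n \<ge> 4"
    using q by (simp add: filterlim_at_top)
  then show ?thesis
    using small nonempty eventually_ge_at_top[of 3]
  proof eventually_elim
    case (elim n)
    obtain x where x: "x \<in> tables n (q n) (r n) (c n)" using elim by blast
    show ?case
      unfolding dg_tmix_def
    proof (rule cInf_greatest)
      show "{t. t \<ge> 0 \<and> dg_d n (q n) (r n) (c n) t \<le> \<epsilon>} \<noteq> {}"
        using exists_time_dg_d_le[of n "q n" "r n" "c n" \<epsilon>] elim eps by auto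
    next
      fix t assume "t \<in> {t. t \<ge> 0 \<and> dg_d n (q n) (r n) (c n) t \<le> \<epsilon>}"
      then have "t \<ge> 0" "dg_tv n (q n) (r n) (c n) t x \<le> \<epsilon>"
        using dg_tv_le_dg_d[OF x, of t] by auto
      then show "real n ^ 2 * real (q n) ^ 2 / (8 * pi ^ 2) *
          (ln (real n) + ln (1 - 1 / real n) + 1/2 * ln ((inverse \<epsilon> - 1) / 5)) \<le> t"
        using elim eps by (intro time_ge_of_dg_tv_le[OF x]) (auto simp: \<kappa>_def)
    qed
  qed
qed

section \<open>Partition functions of mean pairwise energies\<close>

text \<open>Finite abelian groups on a carrier set, presented by subtraction: in this form both the residues modulo
  \<open>q\<close> and, coordinatewise, the based functions are instances.\<close>

locale diff_group =
  fixes R :: "'a set" and d :: "'a \<Rightarrow> 'a \<Rightarrow> 'a" and z :: 'a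
  assumes finite_R: "finite R"
    and zero_in: "z \<in> R"
    and diff_in: "a \<in> R \<Longrightarrow> b \<in> R \<Longrightarrow> d a b \<in> R"
    and diff_diff: "a \<in> R \<Longrightarrow> b \<in> R \<Longrightarrow> e \<in> R \<Longrightarrow> d (d a e) (d b e) = d a b"
    and diff_zero: "a \<in> R \<Longrightarrow> d a z = a"
    and diff_self: "a \<in> R \<Longrightarrow> d a a = z"
    and diff_neg_neg: "a \<in> R \<Longrightarrow> b \<in> R \<Longrightarrow> d (d z a) (d z b) = d b a"

definition pow_diff :: "nat \<Rightarrow> ('a \<Rightarrow> 'a \<Rightarrow> 'a) \<Rightarrow> (nat \<Rightarrow> 'a) \<Rightarrow> (nat \<Rightarrow> 'a) \<Rightarrow> nat \<Rightarrow> 'a" where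
  "pow_diff n d x y = (\<lambda>i\<in>{..<n}. d (x i) (y i))"

text \<open>Each unordered pair is counted twice. With the divisor 2n and an even potential, a
  configuration with one nonzero coordinate w has energy (1 - 1/n) V(w), nearly the energy of w
  alone.\<close>

definition energy :: "nat \<Rightarrow> ('a \<Rightarrow> 'a \<Rightarrow> 'a) \<Rightarrow> ('a \<Rightarrow> real) \<Rightarrow> (nat \<Rightarrow> 'a) \<Rightarrow> real" where
  "energy n d V x = (\<Sum>i<n. \<Sum>j<n. V (d (x i) (x j))) / (2 * real n)"

text \<open>The partition function of the nonzero elements at inverse temperature
  \<open>s\<close>.\<close>

definition weight :: "'a set \<Rightarrow> 'a \<Rightarrow> ('a \<Rightarrow> real) \<Rightarrow> real \<Rightarrow> real" where
  "weight R z V s = (\<Sum>w\<in>R - {z}. exp (- s * V w))"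

lemma weight_nonneg: "0 \<le> weight R z V s"
  by (simp add: weight_def sum_nonneg)

lemma weight_scale: "weight R z (\<lambda>w. s * V w) s' = weight R z V (s * s')"
  by (simp add: weight_def mult_ac)

lemma energy_scale: "energy n d (\<lambda>w. s * V w) x = s * energy n d V x"
  by (simp add: energy_def sum_distrib_left)

lemma (in diff_group) based_in: "x \<in> based_funs n R z \<Longrightarrow> i < n \<Longrightarrow> x i \<in> R"
  using based_funsD(1,2)[of x n R z i] zero_in by (cases "i = 0") auto

lemma (in diff_group) diff_group_based_funs:
  "diff_group (based_funs n R z) (pow_diff n d) (const_fun n z)"
proof
  show "finite (based_funs n R z)" by (rule finite_based_funs[OF finite_R])
  show "const_fun n z \<in> based_funs n R z" by (rule const_fun_in_based_funs[OF zero_in])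
  fix a b assume ab: "a \<in> based_funs n R z" "b \<in> based_funs n R z"
  show "pow_diff n d a b \<in> based_funs n R z"
    using diff_in[OF based_in[OF ab(1)] based_in[OF ab(2)]] based_funsD(1)[OF ab(1)] based_funsD(1)[OF ab(2)] diff_self[OF zero_in]
    by (auto simp: based_funs_def pow_diff_def)
  show "pow_diff n d (pow_diff n d (const_fun n z) a) (pow_diff n d (const_fun n z) b) = pow_diff n d b a"
    using diff_neg_neg[OF based_in[OF ab(1)] based_in[OF ab(2)]]
    by (auto simp: pow_diff_def const_fun_def fun_eq_iff restrict_def)
  show "pow_diff n d a (const_fun n z) = a"
    using diff_zero[OF based_in[OF ab(1)]] based_funsD(3)[OF ab(1)]
    by (auto simp: pow_diff_def const_fun_def fun_eq_iff restrict_def extensional_def)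
  show "pow_diff n d a a = const_fun n z"
    using diff_self[OF based_in[OF ab(1)]]
    by (auto simp: pow_diff_def const_fun_def fun_eq_iff restrict_def)
  fix e assume e: "e \<in> based_funs n R z"
  show "pow_diff n d (pow_diff n d a e) (pow_diff n d b e) = pow_diff n d a b"
    using diff_diff[OF based_in[OF ab(1)] based_in[OF ab(2)] based_in[OF e]]
    by (auto simp: pow_diff_def fun_eq_iff restrict_def)
qed

locale potential = diff_group +
  fixes V :: "'a \<Rightarrow> real"
  assumes V_nonneg: "a \<in> R \<Longrightarrow> 0 \<le> V a"
    and V_zero: "V z = 0"
    and V_neg: "a \<in> R \<Longrightarrow> V (d z a) = V a"
begin

lemma V_sym: "a \<in> R \<Longrightarrow> b \<in> R \<Longrightarrow> V (d b a) = V (d a b)"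
  using V_neg[OF diff_in, of a b] diff_diff[of b a b] diff_self[of b] diff_in by simp

lemma potential_scale: "s \<ge> 0 \<Longrightarrow> potential R d z (\<lambda>w. s * V w)"
  by unfold_locales (auto simp: V_nonneg V_zero V_neg)

text \<open>Closes the structure under passing to energies; this permits using the same estimate on
  rows of residues and then on matrices of rows.\<close>

lemma potential_energy: "potential (based_funs n R z) (pow_diff n d) (const_fun n z) (energy n d V)"
proof -
  interpret B: diff_group "based_funs n R z" "pow_diff n d" "const_fun n z"
    by (rule diff_group_based_funs)
  show ?thesis
  proof
    fix a assume a: "a \<in> based_funs n R z"
    show "0 \<le> energy n d V a"
      unfolding energy_def
      by (intro divide_nonneg_nonneg sum_nonneg V_nonneg diff_in based_in[OF a]) auto
    have "d (d z (a i)) (d z (a j)) = d (a j) (a i)" if "i < n" "j < n" for i j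
      by (rule diff_neg_neg) (use that based_in[OF a] in auto)
    then have "V (d (d z (a i)) (d z (a j))) = V (d (a i) (a j))" if "i < n" "j < n" for i j
      using that V_sym based_in[OF a] by simp
    then show "energy n d V (pow_diff n d (const_fun n z) a) = energy n d V a"
      by (simp add: energy_def pow_diff_def const_fun_def)
  qed (simp add: energy_def const_fun_def diff_self[OF zero_in] V_zero)
qed

definition supp :: "nat \<Rightarrow> (nat \<Rightarrow> 'a) \<Rightarrow> nat set" where
  "supp n u = {i. i < n \<and> u i \<noteq> z}"

text \<open>The representative of the same class modulo constants that vanishes at \<open>p\<close>
  instead of 0. Rebasing at 0 undoes it, whatever \<open>p\<close> was.\<close>

definition rebase :: "nat \<Rightarrow> nat \<Rightarrow> (nat \<Rightarrow> 'a) \<Rightarrow> nat \<Rightarrow> 'a" where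
  "rebase n p x = (\<lambda>i\<in>{..<n}. d (x i) (x p))"

lemma supp_le: "card (supp n u) \<le> n"
  using card_mono[of "{..<n}" "supp n u"] by (auto simp: supp_def)

text \<open>The inverse temperature may depend on the size of the support because the sparse energy
  bound loses the factor 1 - m/n.\<close>

lemma sum_prod_by_supp:
  assumes K: "K \<subseteq> {..n}"
  shows "(\<Sum>u | u \<in> Pi\<^sub>E {..<n} (\<lambda>_. R) \<and> card (supp n u) \<in> K. \<Prod>i<n. exp (- s (card (supp n u)) * V (u i)))
    = (\<Sum>m\<in>K. real (n choose m) * weight R z V (s m) ^ m)"
proof -
  let ?U = "{u. u \<in> Pi\<^sub>E {..<n} (\<lambda>_. R) \<and> card (supp n u) \<in> K}"
  let ?P = "{A. A \<subseteq> {..<n} \<and> card A \<in> K}"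
  have finU: "finite ?U"
    by (rule finite_subset[OF _ finite_PiE[of "{..<n}" "\<lambda>_. R"]]) (use finite_R in auto)
  have finP: "finite ?P" by (rule finite_subset[of _ "Pow {..<n}"]) auto
  have finK: "finite K" using K finite_subset by blast
  have "(\<Sum>u\<in>?U. \<Prod>i<n. exp (- s (card (supp n u)) * V (u i)))
      = (\<Sum>A\<in>?P. \<Sum>u | u \<in> ?U \<and> supp n u = A. \<Prod>i<n. exp (- s (card (supp n u)) * V (u i)))"
    by (rule sum.group[symmetric, OF finU finP]) (auto simp: supp_def)
  also have "\<dots> = (\<Sum>A\<in>?P. weight R z V (s (card A)) ^ card A)"
  proof (intro sum.cong refl)
    fix A assume A: "A \<in> ?P"
    let ?B = "\<lambda>i. if i \<in> A then R - {z} else {z}"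
    have "{u \<in> ?U. supp n u = A} = Pi\<^sub>E {..<n} ?B"
    proof (intro set_eqI iffI)
      fix u assume "u \<in> {u \<in> ?U. supp n u = A}"
      then show "u \<in> Pi\<^sub>E {..<n} ?B"
        by (auto simp: supp_def PiE_iff)
    next
      fix u assume u: "u \<in> Pi\<^sub>E {..<n} ?B"
      have *: "u i \<in> ?B i" if "i < n" for i
        using PiE_mem[OF u, of i] that by simp
      have "supp n u = A"
      proof (rule set_eqI)
        fix i
        show "i \<in> supp n u \<longleftrightarrow> i \<in> A"
        proof (cases "i < n")
          case True
          then show ?thesis using *[OF True] by (simp add: supp_def split: if_splits)
        next
          case False
          then show ?thesis using A by (auto simp: supp_def)
        qed
      qed
      moreover have "u i \<in> R" if "i < n" for i
        using *[OF that] zero_in by (auto split: if_splits)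
      ultimately show "u \<in> {u \<in> ?U. supp n u = A}"
        using A u by (auto simp: PiE_iff)
    qed
    then have "(\<Sum>u | u \<in> ?U \<and> supp n u = A. \<Prod>i<n. exp (- s (card (supp n u)) * V (u i)))
       = (\<Sum>u\<in>Pi\<^sub>E {..<n} ?B. \<Prod>i<n. exp (- s (card A) * V (u i)))"
      by (intro sum.cong) auto
    also have "\<dots> = (\<Prod>i<n. \<Sum>w\<in>?B i. exp (- s (card A) * V w))"
      by (rule prod_sum_PiE[symmetric]) (use finite_R in auto)
    also have "\<dots> = (\<Prod>i\<in>A. weight R z V (s (card A)))"
      using A by (intro prod.mono_neutral_cong_right) (auto simp: weight_def V_zero)
    finally show "(\<Sum>u | u \<in> ?U \<and> supp n u = A. \<Prod>i<n. exp (- s (card (supp n u)) * V (u i)))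
       = weight R z V (s (card A)) ^ card A"
      by simp
  qed
  also have "\<dots> = (\<Sum>m\<in>K. \<Sum>A | A \<in> ?P \<and> card A = m. weight R z V (s (card A)) ^ card A)"
    by (rule sum.group[symmetric, OF finP finK]) auto
  also have "\<dots> = (\<Sum>m\<in>K. real (n choose m) * weight R z V (s m) ^ m)"
  proof (intro sum.cong refl)
    fix m assume "m \<in> K"
    then have "{A \<in> ?P. card A = m} = {A. A \<subseteq> {..<n} \<and> card A = m}" by auto
    then show "(\<Sum>A | A \<in> ?P \<and> card A = m. weight R z V (s (card A)) ^ card A) = real (n choose m) * weight R z V (s m) ^ m"
      using n_subsets[of "{..<n}" m] by simp
  qed
  finally show ?thesis .
qed

lemma rebase_in:
  assumes "x \<in> based_funs n R z" "p < n"
  shows "rebase n p x \<in> Pi\<^sub>E {..<n} (\<lambda>_. R)"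
  using assms diff_in based_in[OF assms(1)] by (auto simp: rebase_def)

lemma rebase_inverse:
  assumes "x \<in> based_funs n R z" "p < n"
  shows "rebase n 0 (rebase n p x) = x"
proof
  fix i
  show "rebase n 0 (rebase n p x) i = x i"
  proof (cases "i < n")
    case True
    then have "rebase n 0 (rebase n p x) i = d (x i) (x 0)"
      using assms(2) by (simp add: rebase_def diff_diff based_in[OF assms(1)])
    then show ?thesis
      using True based_funsD(1)[OF assms(1), of 0] diff_zero[OF based_in[OF assms(1) True]] by simp
  next
    case False
    then show ?thesis using based_funsD(3)[OF assms(1)] by (simp add: rebase_def extensional_def)
  qed
qed

lemma supp_rebase_pos:
  assumes "x \<in> based_funs n R z" "x \<noteq> const_fun n z" "p < n"
  shows "card (supp n (rebase n p x)) \<ge> 1"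
proof (rule ccontr)
  assume "\<not> ?thesis"
  then have "card (supp n (rebase n p x)) = 0" by simp
  moreover have "finite (supp n (rebase n p x))" by (simp add: supp_def)
  ultimately have "supp n (rebase n p x) = {}" by simp
  then have "rebase n p x = const_fun n z"
    by (auto simp: supp_def rebase_def const_fun_def fun_eq_iff restrict_def)
  then have "x = rebase n 0 (const_fun n z)"
    using rebase_inverse[OF assms(1,3)] by simp
  also have "\<dots> = const_fun n z"
    using assms(3) by (auto simp: rebase_def const_fun_def diff_self[OF zero_in] fun_eq_iff restrict_def)
  finally show False using assms(2) by simp
qed

text \<open>Only pairs with exactly one coordinate in the support are kept; their difference is a
  value of \<open>u\<close> up to sign. Each support coordinate has n - m such partners, in both
  orders, and division by 2n leaves 1 - m/n.\<close>

lemma energy_ge_sparse: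
  assumes x: "x \<in> based_funs n R z" and p: "p < n"
  defines "u \<equiv> rebase n p x"
  shows "(1 - real (card (supp n u)) / real n) * (\<Sum>i<n. V (u i)) \<le> energy n d V x"
proof -
  let ?A = "supp n u" and ?C = "{..<n} - supp n u"
  have sub: "?A \<subseteq> {..<n}" and fin: "finite ?A" by (auto simp: supp_def)
  have uR: "u i \<in> R" if "i < n" for i
    using rebase_in[OF x p] that by (auto simp: u_def)
  have uz: "u i = z" if "i \<in> ?C" for i
    using that by (auto simp: supp_def)
  have VA: "(\<Sum>i<n. V (u i)) = (\<Sum>i\<in>?A. V (u i))"
    using sub uz V_zero by (intro sum.mono_neutral_right) auto
  have du: "d (x i) (x j) = d (u i) (u j)" if "i < n" "j < n" for i j
    using that p by (simp add: u_def rebase_def diff_diff based_in[OF x])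
  have nn: "0 \<le> V (d (u i) (u j))" if "i < n" "j < n" for i j
    using that by (intro V_nonneg diff_in uR)
  have "(\<Sum>i<n. \<Sum>j<n. V (d (x i) (x j))) = (\<Sum>i<n. \<Sum>j<n. V (d (u i) (u j)))"
    by (simp add: du)
  also have "\<dots> = (\<Sum>i\<in>?C. \<Sum>j<n. V (d (u i) (u j))) + (\<Sum>i\<in>?A. \<Sum>j<n. V (d (u i) (u j)))"
    by (rule sum.subset_diff[OF sub]) simp
  also have "(\<Sum>i\<in>?C. \<Sum>j<n. V (d (u i) (u j))) \<ge> (\<Sum>i\<in>?C. \<Sum>j\<in>?A. V (u j))"
  proof (intro sum_mono)
    fix i assume i: "i \<in> ?C"
    have "(\<Sum>j\<in>?A. V (u j)) = (\<Sum>j\<in>?A. V (d (u i) (u j)))"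
      using sub by (intro sum.cong refl) (auto simp: uz[OF i] V_neg uR)
    also have "\<dots> \<le> (\<Sum>j<n. V (d (u i) (u j)))"
      using sub i nn by (intro sum_mono2) auto
    finally show "(\<Sum>j\<in>?A. V (u j)) \<le> (\<Sum>j<n. V (d (u i) (u j)))" .
  qed
  moreover have "(\<Sum>i\<in>?A. \<Sum>j<n. V (d (u i) (u j))) \<ge> (\<Sum>i\<in>?A. \<Sum>j\<in>?C. V (u i))"
  proof (intro sum_mono)
    fix i assume i: "i \<in> ?A"
    have "(\<Sum>j\<in>?C. V (u i)) = (\<Sum>j\<in>?C. V (d (u i) (u j)))"
      using sub i by (intro sum.cong refl) (auto simp: uz diff_zero uR)
    also have "\<dots> \<le> (\<Sum>j<n. V (d (u i) (u j)))"
      using sub i nn by (intro sum_mono2) auto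
    finally show "(\<Sum>j\<in>?C. V (u i)) \<le> (\<Sum>j<n. V (d (u i) (u j)))" .
  qed
  ultimately have "(\<Sum>i<n. \<Sum>j<n. V (d (x i) (x j))) \<ge> 2 * (real (card ?C) * (\<Sum>i\<in>?A. V (u i)))"
    by (simp add: sum_distrib_left[symmetric])
  then have "2 * (real (card ?C) * (\<Sum>i\<in>?A. V (u i))) / (2 * real n) \<le> energy n d V x"
    unfolding energy_def by (intro divide_right_mono) auto
  moreover have "real (card ?C) = real n - real (card ?A)"
    using sub fin card_mono[OF _ sub] by (simp add: card_Diff_subset of_nat_diff)
  ultimately show ?thesis
    using p by (simp add: VA field_simps)
qed

text \<open>The energy is the mean over base points \<open>p\<close> of half the sum of V(x_i -
  x_p), and the exponential is convex. For fixed \<open>p\<close> the bound is a product over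
  coordinates.\<close>

lemma exp_energy_le_average:
  assumes x: "x \<in> based_funs n R z" and n: "n > 0"
  shows "exp (- energy n d V x) \<le> (\<Sum>p<n. \<Prod>i<n. exp (- (1/2) * V (rebase n p x i))) / real n"
proof -
  define a where "a p = - (1/2) * (\<Sum>i<n. V (d (x i) (x p)))" for p
  have "exp (\<Sum>p<n. (1 / real n) *\<^sub>R a p) \<le> (\<Sum>p<n. (1 / real n) * exp (a p))"
    by (rule convex_on_sum[OF _ _ exp_convex]) (use n in auto)
  moreover have "(\<Sum>p<n. (1 / real n) *\<^sub>R a p) = - energy n d V x"
    unfolding a_def energy_def using sum.swap[of "\<lambda>i j. V (d (x i) (x j))" "{..<n}" "{..<n}"]
    by (simp add: sum_divide_distrib[symmetric] sum_negf sum_distrib_left[symmetric] field_simps)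
  moreover have "exp (a p) = (\<Prod>i<n. exp (- (1/2) * V (rebase n p x i)))" for p
    by (simp add: a_def sum_distrib_left exp_sum rebase_def sum_negf[symmetric])
  ultimately show ?thesis
    by (simp add: sum_divide_distrib)
qed

text \<open>If some coordinate agrees with all but at most a quarter of the others, rebasing at it shows a
  sparse configuration of nearly full energy.  Otherwise Jensen's inequality over the base
  point factorises the sum at the price of half the energy.\<close>

lemma sum_exp_energy_le:
  assumes n: "n > 0"
  shows "(\<Sum>x\<in>based_funs n R z - {const_fun n z}. exp (- energy n d V x))
    \<le> (\<Sum>m\<in>{1..n div 4}. real (n choose m) * weight R z V (1 - real m / real n) ^ m)
     + (\<Sum>m\<in>{n div 4<..n}. real (n choose m) * weight R z V (1/2) ^ m)"
proof -
  let ?B = "based_funs n R z - {const_fun n z}"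
  define S where "S = {x \<in> ?B. \<exists>p<n. card (supp n (rebase n p x)) \<le> n div 4}"
  have finB: "finite ?B" by (simp add: finite_based_funs[OF finite_R])
  have "\<forall>x\<in>S. \<exists>p. p < n \<and> card (supp n (rebase n p x)) \<le> n div 4"
    by (auto simp: S_def)
  then obtain \<pi> where \<pi>: "\<And>x. x \<in> S \<Longrightarrow> \<pi> x < n"
    "\<And>x. x \<in> S \<Longrightarrow> card (supp n (rebase n (\<pi> x) x)) \<le> n div 4"
    by metis
  define g where "g x = rebase n (\<pi> x) x" for x
  let ?U = "\<lambda>K. {u. u \<in> Pi\<^sub>E {..<n} (\<lambda>_. R) \<and> card (supp n u) \<in> K}"
  have finU: "finite (?U K)" for K
    by (rule finite_subset[OF _ finite_PiE[of "{..<n}" "\<lambda>_. R"]]) (use finite_R in auto)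
  \<comment> \<open>The base point depends on \<open>x\<close>, yet nothing is counted twice:
    rebasing at 0 recovers \<open>x\<close> without knowing which base point was used.\<close>
  have inj: "inj_on g S"
    by (rule inj_on_inverseI[of _ "rebase n 0"]) (auto simp: g_def S_def intro!: rebase_inverse \<pi>)
  have sparse: "(\<Sum>x\<in>S. exp (- energy n d V x))
     \<le> (\<Sum>m\<in>{1..n div 4}. real (n choose m) * weight R z V (1 - real m / real n) ^ m)"
  proof -
    have "(\<Sum>x\<in>S. exp (- energy n d V x))
      \<le> (\<Sum>x\<in>S. \<Prod>i<n. exp (- (1 - real (card (supp n (g x))) / real n) * V (g x i)))"
    proof (rule sum_mono)
      fix x assume x: "x \<in> S"
      have "(1 - real (card (supp n (g x))) / real n) * (\<Sum>i<n. V (g x i)) \<le> energy n d V x"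
        unfolding g_def using x by (intro energy_ge_sparse \<pi>) (auto simp: S_def)
      then have "exp (- energy n d V x) \<le> exp (\<Sum>i<n. - (1 - real (card (supp n (g x))) / real n) * V (g x i))"
        by (simp only: sum_distrib_left[symmetric] exp_le_cancel_iff)
      then show "exp (- energy n d V x) \<le> (\<Prod>i<n. exp (- (1 - real (card (supp n (g x))) / real n) * V (g x i)))"
        by (simp only: exp_sum finite_lessThan)
    qed
    also have "\<dots> = (\<Sum>u\<in>g ` S. \<Prod>i<n. exp (- (1 - real (card (supp n u)) / real n) * V (u i)))"
      by (simp add: sum.reindex[OF inj])
    also have "\<dots> \<le> (\<Sum>u\<in>?U {1..n div 4}. \<Prod>i<n. exp (- (1 - real (card (supp n u)) / real n) * V (u i)))"
      using \<pi> rebase_in supp_rebase_pos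
      by (intro sum_mono2 finU) (force simp: g_def S_def intro!: prod_nonneg)+
    also have "\<dots> = (\<Sum>m\<in>{1..n div 4}. real (n choose m) * weight R z V (1 - real m / real n) ^ m)"
      by (rule sum_prod_by_supp) auto
    finally show ?thesis .
  qed
  have dense: "(\<Sum>x\<in>?B - S. exp (- energy n d V x)) \<le> (\<Sum>m\<in>{n div 4<..n}. real (n choose m) * weight R z V (1/2) ^ m)"
  proof -
    let ?F = "\<lambda>u. \<Prod>i<n. exp (- (1/2) * V (u i))"
    have "(\<Sum>x\<in>?B - S. exp (- energy n d V x)) \<le> (\<Sum>x\<in>?B - S. (\<Sum>p<n. ?F (rebase n p x)) / real n)"
      by (intro sum_mono exp_energy_le_average n) auto
    also have "\<dots> = (\<Sum>p<n. \<Sum>x\<in>?B - S. ?F (rebase n p x)) / real n"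
      by (subst sum.swap) (simp add: sum_divide_distrib)
    also have "\<dots> \<le> (\<Sum>p<n. \<Sum>u\<in>?U {n div 4<..n}. ?F u) / real n"
    proof (intro divide_right_mono sum_mono)
      fix p assume p: "p \<in> {..<n}"
      have "inj_on (rebase n p) (?B - S)"
        by (rule inj_on_inverseI[of _ "rebase n 0"]) (use p in \<open>auto intro!: rebase_inverse\<close>)
      then have "(\<Sum>x\<in>?B - S. ?F (rebase n p x)) = (\<Sum>u\<in>rebase n p ` (?B - S). ?F u)"
        by (simp add: sum.reindex)
      also have "\<dots> \<le> (\<Sum>u\<in>?U {n div 4<..n}. ?F u)"
      proof (intro sum_mono2 finU subsetI)
        fix u assume "u \<in> rebase n p ` (?B - S)"
        then obtain x where x: "x \<in> ?B - S" "u = rebase n p x" by blast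
        then have "\<not> card (supp n u) \<le> n div 4"
          using p by (auto simp: S_def)
        then show "u \<in> ?U {n div 4<..n}"
          using x p rebase_in supp_le[of n u] by auto
      qed (auto intro: prod_nonneg)
      finally show "(\<Sum>x\<in>?B - S. ?F (rebase n p x)) \<le> (\<Sum>u\<in>?U {n div 4<..n}. ?F u)" .
    qed auto
    also have "\<dots> = (\<Sum>u\<in>?U {n div 4<..n}. ?F u)"
      using n by simp
    also have "\<dots> = (\<Sum>m\<in>{n div 4<..n}. real (n choose m) * weight R z V (1/2) ^ m)"
      by (rule sum_prod_by_supp) auto
    finally show ?thesis .
  qed
  have "(\<Sum>x\<in>?B. exp (- energy n d V x)) = (\<Sum>x\<in>?B - S. exp (- energy n d V x)) + (\<Sum>x\<in>S. exp (- energy n d V x))"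
    by (rule sum.subset_diff[OF _ finB]) (auto simp: S_def)
  then show ?thesis
    using sparse dense by linarith
qed

end

section \<open>Bounds for the sums over support sizes\<close>

lemma power_self_le_fact: "real m ^ m \<le> 3 ^ m * fact m"
proof -
  have "(\<lambda>k. real m ^ k /\<^sub>R fact k) sums exp (real m)"
    by (rule exp_converges)
  \<comment> \<open>A single term of the exponential series at m is at most e^m, and e <= 3.\<close>
  then have "real m ^ m /\<^sub>R fact m \<le> exp (real m)"
    using sum_le_suminf[of "\<lambda>k. real m ^ k /\<^sub>R fact k" "{m}"] by (auto simp: sums_iff)
  also have "exp (real m) = exp 1 ^ m"
    by (simp add: exp_of_nat_mult[symmetric])
  also have "\<dots> \<le> 3 ^ m"
    using exp_le by (intro power_mono) auto
  finally show ?thesis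
    by (simp add: field_simps)
qed

lemma binomial_le_power: "m > 0 \<Longrightarrow> real (n choose m) \<le> (3 * real n / real m) ^ m"
proof -
  assume m: "m > 0"
  have "real (n choose m) * real m ^ m \<le> real (n choose m) * (3 ^ m * fact m)"
    by (intro mult_left_mono power_self_le_fact) auto
  also have "\<dots> = 3 ^ m * real ((n choose m) * fact m)" by simp
  also have "\<dots> \<le> 3 ^ m * real (n ^ m)"
    by (intro mult_left_mono of_nat_mono binomial_fact_pow) auto
  finally show ?thesis
    using m by (simp add: power_divide power_mult_distrib field_simps)
qed

lemma sum_power_le:
  fixes y :: real
  assumes "0 \<le> y" "y \<le> 1/2"
  shows "(\<Sum>m\<in>{1..k}. y ^ m) \<le> 2 * y"
proof -
  have "(\<Sum>m\<in>{1..k}. y ^ m) = y * (\<Sum>m<k. y ^ m)"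
    unfolding sum_distrib_left
    by (rule sum.reindex_bij_witness[of _ Suc "\<lambda>m. m - 1"]) (auto simp: power_eq_if)
  also have "\<dots> \<le> y * 2"
  proof (intro mult_left_mono assms(1))
    have "(\<Sum>m<k. y ^ m) \<le> (\<Sum>m<k. (1/2) ^ m)"
      using assms by (intro sum_mono power_mono) auto
    also have "\<dots> \<le> 2"
      by (simp add: sum_gp_strict)
    finally show "(\<Sum>m<k. y ^ m) \<le> 2" .
  qed
  finally show ?thesis by (simp add: mult.commute)
qed

text \<open>The loss N^(2sm/n) is at most 2m by \<open>H\<close>, and this m cancels the one in
  (3n/m)^m. What remains is a geometric series with ratio 6 K n N^(-2s).\<close>

lemma sparse_sum_le:
  fixes N K s :: real
  assumes n: "n > 0" and N: "N \<ge> 1" and K: "K \<ge> 0" and s: "0 \<le> s" "s \<le> 1"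
    and H: "\<And>m. m \<in> {1..n div 4} \<Longrightarrow> N powr (2 * real m / real n) \<le> 2 * real m"
    and small: "6 * K * real n * N powr (- 2 * s) \<le> 1/2"
    and w: "\<And>m. m \<in> {1..n div 4} \<Longrightarrow> 0 \<le> w m \<and> w m \<le> K * N powr (- 2 * s * (1 - real m / real n))"
  shows "(\<Sum>m\<in>{1..n div 4}. real (n choose m) * w m ^ m) \<le> 12 * K * real n * N powr (- 2 * s)"
proof -
  let ?y = "6 * K * real n * N powr (- 2 * s)"
  have "real (n choose m) * w m ^ m \<le> ?y ^ m" if m: "m \<in> {1..n div 4}" for m
  proof -
    have "w m \<le> K * (N powr (- 2 * s) * N powr (s * (2 * real m / real n)))"
      using w[OF m] by (simp add: powr_add[symmetric] algebra_simps)
    also have "\<dots> \<le> K * (N powr (- 2 * s) * (2 * real m))"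
    proof (intro mult_left_mono)
      have "N powr (s * (2 * real m / real n)) \<le> N powr (1 * (2 * real m / real n))"
        using N s by (intro powr_mono mult_right_mono) auto
      then show "N powr (s * (2 * real m / real n)) \<le> 2 * real m"
        using H[OF m] by simp
    qed (use K in auto)
    finally have w': "w m \<le> K * (N powr (- 2 * s) * (2 * real m))" .
    have "real (n choose m) * w m ^ m \<le> (3 * real n / real m) ^ m * (K * (N powr (- 2 * s) * (2 * real m))) ^ m"
      using m w[OF m] w' by (intro mult_mono binomial_le_power power_mono) auto
    also have "\<dots> = ((3 * real n / real m) * (K * (N powr (- 2 * s) * (2 * real m)))) ^ m"
      by (rule power_mult_distrib[symmetric])
    also have "(3 * real n / real m) * (K * (N powr (- 2 * s) * (2 * real m))) = ?y"
      using m by simp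
    finally show ?thesis .
  qed
  then have "(\<Sum>m\<in>{1..n div 4}. real (n choose m) * w m ^ m) \<le> (\<Sum>m\<in>{1..n div 4}. ?y ^ m)"
    by (rule sum_mono)
  also have "\<dots> \<le> 2 * ?y"
    using K small by (intro sum_power_le) auto
  finally show ?thesis by simp
qed

text \<open>All binomial coefficients together are 2^n = 16^(n/4), and every exponent in the range
  is at least n/4.\<close>

lemma dense_sum_le:
  fixes w v :: real
  assumes w: "0 \<le> w" "w \<le> v" and v: "0 < v" "v \<le> 1"
  shows "(\<Sum>m\<in>{n div 4<..n}. real (n choose m) * w ^ m) \<le> (16 * v) powr (real n / 4)"
proof -
  have "(\<Sum>m\<in>{n div 4<..n}. real (n choose m) * w ^ m) \<le> (\<Sum>m\<in>{n div 4<..n}. real (n choose m) * v powr (real n / 4))"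
  proof (intro sum_mono mult_left_mono)
    fix m assume "m \<in> {n div 4<..n}"
    then have "real n / 4 \<le> real m" by auto
    have "w ^ m \<le> v ^ m" using w by (intro power_mono) auto
    also have "\<dots> = v powr real m" using v by (simp add: powr_realpow)
    also have "\<dots> \<le> v powr (real n / 4)"
      using v \<open>real n / 4 \<le> real m\<close> by (intro powr_mono') auto
    finally show "w ^ m \<le> v powr (real n / 4)" .
  qed auto
  also have "\<dots> = (\<Sum>m\<in>{n div 4<..n}. real (n choose m)) * v powr (real n / 4)"
    by (rule sum_distrib_right[symmetric])
  also have "\<dots> \<le> (\<Sum>m\<le>n. real (n choose m)) * v powr (real n / 4)"
    by (intro mult_right_mono sum_mono2) auto
  also have "(\<Sum>m\<le>n. real (n choose m)) = 16 powr (real n / 4)"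
  proof -
    have "(\<Sum>m\<le>n. real (n choose m)) = real (2 ^ n)"
      by (simp only: of_nat_sum[symmetric] choose_row_sum)
    also have "\<dots> = 2 powr (4 * (real n / 4))"
      by (simp add: powr_realpow)
    also have "\<dots> = (2 powr 4) powr (real n / 4)"
      by (rule powr_powr[symmetric])
    finally show ?thesis by simp
  qed
  also have "16 powr (real n / 4) * v powr (real n / 4) = (16 * v) powr (real n / 4)"
    using v by (simp add: powr_mult)
  finally show ?thesis .
qed

section \<open>The two-level estimate over residues modulo q\<close>

lemma diff_group_mod:
  assumes "q > 0"
  shows "diff_group {0..<int q} (\<lambda>a b. (a - b) mod int q) 0"
proof
  fix a b e :: int
  show "((a - e) mod int q - (b - e) mod int q) mod int q = (a - b) mod int q"
    by (simp add: mod_diff_eq)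
  show "((0 - a) mod int q - (0 - b) mod int q) mod int q = (b - a) mod int q"
    unfolding mod_diff_eq by simp
qed (use assms in auto)

lemma osc_mod: "q > 0 \<Longrightarrow> osc q (k mod int q) = osc q k"
  by (rule osc_cong_mod) (auto simp: mod_eq_dvd_iff[symmetric])

lemma potential_osc:
  assumes "q > 0" "\<kappa> \<ge> 0"
  shows "potential {0..<int q} (\<lambda>a b. (a - b) mod int q) 0 (\<lambda>k. \<kappa> * osc q k)"
proof -
  interpret diff_group "{0..<int q}" "\<lambda>a b. (a - b) mod int q" 0
    by (rule diff_group_mod[OF assms(1)])
  show ?thesis
    by unfold_locales (use assms in \<open>auto simp: osc_nonneg osc_mod\<close>)
qed

definition osc_energy :: "nat \<Rightarrow> nat \<Rightarrow> real \<Rightarrow> (nat \<Rightarrow> nat \<Rightarrow> int) \<Rightarrow> real" where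
  "osc_energy n q \<kappa> = energy n (pow_diff n (\<lambda>a b. (a - b) mod int q))
     (energy n (\<lambda>a b. (a - b) mod int q) (\<lambda>k. \<kappa> * osc q k))"

lemma osc_energy_eq_gap:
  assumes "q > 0" "n \<ge> 2"
  shows "osc_energy n q \<kappa> \<xi> = \<kappa> * (real n - 1) ^ 2 / 4 * gap n q \<xi>"
proof -
  have "osc q (((\<xi> i j - \<xi> i' j) mod int q - (\<xi> i j' - \<xi> i' j') mod int q) mod int q) = osc q (minor \<xi> i i' j j')" for i i' j j'
    by (simp only: mod_diff_eq osc_mod[OF assms(1)]) (simp add: minor_def algebra_simps)
  then have "osc_energy n q \<kappa> \<xi> = (\<Sum>i<n. \<Sum>i'<n. (\<Sum>j<n. \<Sum>j'<n. \<kappa> * osc q (minor \<xi> i i' j j')) / (2 * real n)) / (2 * real n)"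
    by (simp add: osc_energy_def energy_def pow_diff_def)
  also have "\<dots> = \<kappa> * (\<Sum>i<n. \<Sum>i'<n. \<Sum>j<n. \<Sum>j'<n. osc q (minor \<xi> i i' j j')) / (4 * real n ^ 2)"
    by (simp add: sum_distrib_left[symmetric] sum_divide_distrib[symmetric] power2_eq_square)
  finally show ?thesis
    using assms(2) by (simp add: gap_def field_simps)
qed

text \<open>With w = N^(-s), the linear lower bound dominates the sum by two geometric series in w,
  one for each end of the residue range. Each is at most 2w, and the summand 1 in the hypothesis
  contributes another w, whence 4 w^2.\<close>

lemma weight_osc_le:
  assumes q: "q > 0" and N: "N > 0" and s: "s \<ge> 0" "N powr (- s) \<le> 1/2"
    and osc: "\<And>k. 0 < k \<Longrightarrow> k < int q \<Longrightarrow> ln N * (1 + real_of_int (min k (int q - k))) \<le> \<kappa> * osc q k"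
  shows "weight {0..<int q} 0 (\<lambda>k. \<kappa> * osc q k) s \<le> 4 * N powr (- 2 * s)"
proof -
  let ?w = "N powr (- s)"
  have pt: "exp (- s * (\<kappa> * osc q (int k))) \<le> ?w * ?w ^ k + ?w * ?w ^ (q - k)" if k: "k \<in> {1..<q}" for k
  proof -
    have "exp (- s * (\<kappa> * osc q (int k))) \<le> exp (- s * (ln N * (1 + real_of_int (min (int k) (int q - int k)))))"
      using osc[of "int k"] k s by (auto intro: mult_left_mono)
    also have "real_of_int (min (int k) (int q - int k)) = real (min k (q - k))"
      using k by (auto simp: min_def of_nat_diff)
    also have "exp (- s * (ln N * (1 + real (min k (q - k))))) = ?w * ?w ^ min k (q - k)"
    proof -
      have "?w = exp (- s * ln N)" using N by (simp add: powr_def)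
      then have "?w * ?w ^ m = exp (- s * (ln N * (1 + real m)))" for m
        by (simp only: exp_of_nat_mult[symmetric] exp_add[symmetric]) (simp add: algebra_simps)
      then show ?thesis by (rule sym)
    qed
    also have "\<dots> \<le> ?w * ?w ^ k + ?w * ?w ^ (q - k)"
      by (cases "k \<le> q - k") (auto simp only: min_absorb1 min_absorb2 nle_le intro: add_increasing add_increasing2 mult_nonneg_nonneg powr_ge_zero zero_le_power)
    finally show ?thesis .
  qed
  have "{0..<int q} - {0} = {int 1..<int q}" by auto
  also have "\<dots> = int ` {1..<q}"
    by (rule image_int_atLeastLessThan[symmetric])
  finally have "{0..<int q} - {0} = int ` {1..<q}" .
  then have "weight {0..<int q} 0 (\<lambda>k. \<kappa> * osc q k) s = (\<Sum>k\<in>{1..<q}. exp (- s * (\<kappa> * osc q (int k))))"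
    by (simp add: weight_def sum.reindex)
  also have "\<dots> \<le> (\<Sum>k\<in>{1..<q}. ?w * ?w ^ k + ?w * ?w ^ (q - k))"
    by (intro sum_mono pt)
  also have "\<dots> = ?w * (\<Sum>k\<in>{1..<q}. ?w ^ k) + ?w * (\<Sum>k\<in>{1..<q}. ?w ^ (q - k))"
    by (simp add: sum.distrib sum_distrib_left)
  also have "(\<Sum>k\<in>{1..<q}. ?w ^ (q - k)) = (\<Sum>k\<in>{1..<q}. ?w ^ k)"
    by (rule sum.reindex_bij_witness[of _ "\<lambda>k. q - k" "\<lambda>k. q - k"]) auto
  also have "{1..<q} = {1..q - 1}" using q by auto
  also have "?w * (\<Sum>k\<in>{1..q - 1}. ?w ^ k) + ?w * (\<Sum>k\<in>{1..q - 1}. ?w ^ k) \<le> ?w * (2 * ?w) + ?w * (2 * ?w)"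
    by (intro add_mono mult_left_mono sum_power_le s(2)) auto
  also have "\<dots> = 4 * N powr (- 2 * s)"
    using powr_add[of N "- s" "- s"] by simp
  finally show ?thesis .
qed

text \<open>The row weight is again a constant times N^(-2s), which is why the estimate can be
  iterated. Its factor is 49 n, with 49 = 12 * 4 + 1: sparse rows over the residue constant 4, plus
  the dense rows. At the level of matrices 588 = 12 * 49 and 784 = 16 * 49.\<close>

lemma sum_exp_osc_energy_le:
  fixes N \<kappa> :: real
  assumes n: "n > 0" and q: "q > 0" and N: "N \<ge> 16" and \<kappa>: "\<kappa> \<ge> 0"
    and osc: "\<And>k. 0 < k \<Longrightarrow> k < int q \<Longrightarrow> ln N * (1 + real_of_int (min k (int q - k))) \<le> \<kappa> * osc q k"
    and H: "\<And>m. m \<in> {1..n div 4} \<Longrightarrow> N powr (2 * real m / real n) \<le> 2 * real m"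
    and dense: "(64 * N powr (- 1/2)) powr (real n / 4) \<le> real n * N powr (- 2)" "4 * N powr (- 1/2) \<le> 1"
    and nN: "49 * real n / N \<le> 1" "588 * real n ^ 2 / N ^ 2 \<le> 1"
  shows "(\<Sum>\<xi>\<in>duals n q - {dual0 n}. exp (- osc_energy n q \<kappa> \<xi>))
    \<le> 588 * real n ^ 2 / N ^ 2 + (784 * real n / N) powr (real n / 4)"
proof -
  let ?d = "\<lambda>a b. (a - b) mod int q" and ?V = "\<lambda>k. \<kappa> * osc q k"
  interpret P: potential "{0..<int q}" ?d 0 ?V
    by (rule potential_osc[OF q \<kappa>])
  let ?R = "based_funs n {0..<int q} 0" and ?z = "const_fun n (0::int)"
  interpret Q: potential ?R "pow_diff n ?d" ?z "energy n ?d ?V"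
    by (rule P.potential_energy)
  \<comment> \<open>The exponent 1/4 covers all cases: a scale of at least 1/2 from the matrices
    times a factor of at least 1/2 within the row. At that exponent \<open>N \<ge> 16\<close> gives
    the ratio 1/2.\<close>
  have quarter: "N powr (- s) \<le> 1/2" if "s \<ge> 1/4" for s
  proof -
    have "ln N \<ge> ln (2 ^ 4)"
      using N by (intro ln_mono) auto
    then have "4 * ln 2 \<le> ln N"
      by (subst (asm) ln_realpow) auto
    then have "1/4 * (4 * ln 2) \<le> s * ln N"
      using that by (intro mult_mono) auto
    then have "exp (- (s * ln N)) \<le> exp (- ln (2::real))"
      by simp
    also have "\<dots> = 1/2"
      by (simp only: exp_minus) simp
    also have "exp (- (s * ln N)) = N powr (- s)"
      using N by (simp add: powr_def)
    finally show ?thesis .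
  qed
  have nN2: "real n * N powr (- 2 * s) \<le> real n / N" if "s \<ge> 1/2" for s
  proof -
    have "N powr (- 2 * s) \<le> N powr (- 1)"
      using that N by (intro powr_mono) auto
    then have "real n * N powr (- 2 * s) \<le> real n * N powr (- 1)"
      by (intro mult_left_mono) auto
    also have "\<dots> = real n / N"
      using N by (simp only: powr_minus_divide) simp
    finally show ?thesis .
  qed
  \<comment> \<open>The range of \<open>s\<close> is what the matrix level asks for: 1 - m/n for
    sparse matrices and 1/2 for dense ones.\<close>
  have row: "weight ?R ?z (energy n ?d ?V) s \<le> 49 * real n * N powr (- 2 * s)" if s: "1/2 \<le> s" "s \<le> 1" for s
  proof -
    have "weight ?R ?z (energy n ?d ?V) s = (\<Sum>x\<in>?R - {?z}. exp (- energy n ?d (\<lambda>k. s * ?V k) x))"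
      unfolding weight_def energy_scale by simp
    also have "\<dots> \<le> (\<Sum>m\<in>{1..n div 4}. real (n choose m) * weight {0..<int q} 0 ?V (s * (1 - real m / real n)) ^ m)
     + (\<Sum>m\<in>{n div 4<..n}. real (n choose m) * weight {0..<int q} 0 ?V (s * (1/2)) ^ m)"
      using potential.sum_exp_energy_le[OF P.potential_scale n, of s] s unfolding weight_scale by auto
    also have "\<dots> \<le> 12 * 4 * real n * N powr (- 2 * s) + (16 * (4 * N powr (- 1/2))) powr (real n / 4)"
    proof (rule add_mono)
      show "(\<Sum>m\<in>{1..n div 4}. real (n choose m) * weight {0..<int q} 0 ?V (s * (1 - real m / real n)) ^ m)
          \<le> 12 * 4 * real n * N powr (- 2 * s)"
      proof (rule sparse_sum_le[OF n _ _ _ _ H])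
        show "6 * 4 * real n * N powr (- 2 * s) \<le> 1/2"
          using nN2[OF s(1)] nN(1) by simp
        fix m assume m: "m \<in> {1..n div 4}"
        have "real m / real n \<le> 1/4"
          using m n by (auto simp: field_simps)
        then have "1/2 \<le> 1 - real m / real n" by linarith
        then have "1/2 * (1/2) \<le> s * (1 - real m / real n)"
          using s by (intro mult_mono) auto
        then have "1/4 \<le> s * (1 - real m / real n)" "0 \<le> s * (1 - real m / real n)" by linarith+
        then have "weight {0..<int q} 0 ?V (s * (1 - real m / real n)) \<le> 4 * N powr (- 2 * (s * (1 - real m / real n)))"
          using N by (intro weight_osc_le q quarter osc) simp_all
        then show "0 \<le> weight {0..<int q} 0 ?V (s * (1 - real m / real n)) \<and>
           weight {0..<int q} 0 ?V (s * (1 - real m / real n)) \<le> 4 * N powr (- 2 * s * (1 - real m / real n))"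
          by (simp add: weight_nonneg mult.assoc)
      qed (use N s in auto)
      show "(\<Sum>m\<in>{n div 4<..n}. real (n choose m) * weight {0..<int q} 0 ?V (s * (1/2)) ^ m) \<le> (16 * (4 * N powr (- 1/2))) powr (real n / 4)"
      proof (rule dense_sum_le[OF weight_nonneg])
        have "weight {0..<int q} 0 ?V (s * (1/2)) \<le> 4 * N powr (- 2 * (s * (1/2)))"
          using N s by (intro weight_osc_le q quarter osc) auto
        also have "\<dots> \<le> 4 * N powr (- 1/2)"
          using N s by (intro mult_left_mono powr_mono) auto
        finally show "weight {0..<int q} 0 ?V (s * (1/2)) \<le> 4 * N powr (- 1/2)" .
      qed (use N dense(2) in auto)
    qed
    also have "(16 * (4 * N powr (- 1/2))) powr (real n / 4) \<le> real n * N powr (- 2)"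
      using dense(1) by simp
    also have "\<dots> \<le> real n * N powr (- 2 * s)"
      using N s by (intro mult_left_mono powr_mono) auto
    finally show ?thesis by simp
  qed
  have N2: "N powr (- 2) = 1 / N ^ 2"
    using N by (simp only: powr_minus_divide) simp
  have "(\<Sum>\<xi>\<in>duals n q - {dual0 n}. exp (- osc_energy n q \<kappa> \<xi>))
     \<le> (\<Sum>m\<in>{1..n div 4}. real (n choose m) * weight ?R ?z (energy n ?d ?V) (1 - real m / real n) ^ m)
     + (\<Sum>m\<in>{n div 4<..n}. real (n choose m) * weight ?R ?z (energy n ?d ?V) (1/2) ^ m)"
    unfolding duals_def dual0_def osc_energy_def by (rule Q.sum_exp_energy_le[OF n])
  also have "\<dots> \<le> 12 * (49 * real n) * real n * N powr (- 2 * 1) + (16 * (49 * real n / N)) powr (real n / 4)"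
  proof (rule add_mono)
    show "(\<Sum>m\<in>{1..n div 4}. real (n choose m) * weight ?R ?z (energy n ?d ?V) (1 - real m / real n) ^ m)
       \<le> 12 * (49 * real n) * real n * N powr (- 2 * 1)"
    proof (rule sparse_sum_le[OF n _ _ _ _ H])
      show "6 * (49 * real n) * real n * N powr (- 2 * 1) \<le> 1/2"
        using nN(2) by (simp add: N2 power2_eq_square)
      fix m assume m: "m \<in> {1..n div 4}"
      have "real m / real n \<le> 1/4"
        using m n by (auto simp: field_simps)
      then have "1/2 \<le> 1 - real m / real n" by linarith
      then have "weight ?R ?z (energy n ?d ?V) (1 - real m / real n) \<le> 49 * real n * N powr (- 2 * (1 - real m / real n))"
        by (intro row) simp_all
      then show "0 \<le> weight ?R ?z (energy n ?d ?V) (1 - real m / real n) \<and>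
         weight ?R ?z (energy n ?d ?V) (1 - real m / real n) \<le> 49 * real n * N powr (- 2 * 1 * (1 - real m / real n))"
        by (simp add: weight_nonneg)
    qed (use N in auto)
    show "(\<Sum>m\<in>{n div 4<..n}. real (n choose m) * weight ?R ?z (energy n ?d ?V) (1/2) ^ m) \<le> (16 * (49 * real n / N)) powr (real n / 4)"
    proof (rule dense_sum_le[OF weight_nonneg])
      show "weight ?R ?z (energy n ?d ?V) (1/2) \<le> 49 * real n / N"
        using row[of "1/2"] nN2[of "1/2"] by simp
    qed (use N n nN in auto)
  qed
  also have "\<dots> = 588 * real n ^ 2 / N ^ 2 + (784 * real n / N) powr (real n / 4)"
    by (simp only: mult_1_right N2) (simp add: power2_eq_square)
  finally show ?thesis .
qed

section \<open>The upper bound on the distance\<close>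

lemma cos_le_quartic: "cos x \<le> 1 - x ^ 2 / 2 + x ^ 4 / (24 :: real)"
proof -
  obtain t where t: "cos x = (\<Sum>m<4. cos_coeff m * x ^ m) + cos (t + 1/2 * real 4 * pi) / fact 4 * x ^ 4"
    using Maclaurin_cos_expansion[of x 4] by blast
  have "(\<Sum>m<4. cos_coeff m * x ^ m) = 1 - x ^ 2 / 2"
  proof -
    have "{..<4::nat} = {0, 1, 2, 3}" by auto
    then show ?thesis by (simp add: cos_coeff_def)
  qed
  moreover have "cos (t + 1/2 * real 4 * pi) / fact 4 * x ^ 4 \<le> 1 / fact 4 * x ^ 4"
    by (intro mult_right_mono divide_right_mono) auto
  ultimately show ?thesis
    using t by (simp add: fact_numeral)
qed

text \<open>Otherwise 8/5 would lie in the range where cosine is nonnegative, but the quartic bound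
  is negative there. The value 16/5 is sharp enough for pi^2 <= 4q with q >= 3 and for pi^2 <=
  32/3.\<close>

lemma pi_less_16_5: "pi < 16 / 5"
proof (rule ccontr)
  assume "\<not> pi < 16 / 5"
  then have "0 \<le> cos (8 / 5 :: real)"
    by (intro cos_ge_zero) auto
  moreover have "cos (8 / 5) \<le> 1 - (8 / 5) ^ 2 / 2 + (8 / 5) ^ 4 / (24 :: real)"
    by (rule cos_le_quartic)
  ultimately show False by (simp add: power_divide)
qed

lemma jordan_sin:
  assumes "0 \<le> x" "x \<le> pi / 2"
  shows "2 * x / pi \<le> sin x"
proof -
  have "convex_on {0..pi / 2} (\<lambda>x. - sin x)"
  proof (rule f''_ge0_imp_convex[where f' = "\<lambda>x. - cos x" and f'' = sin])
    show "DERIV (\<lambda>x. - sin x) y :> - cos y" for y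
      by (auto intro!: derivative_eq_intros)
    show "DERIV (\<lambda>x. - cos x) y :> sin y" for y
      by (auto intro!: derivative_eq_intros)
    show "0 \<le> sin y" if "y \<in> {0..pi / 2}" for y
      using that by (intro sin_ge_zero) auto
  qed simp
  from convex_onD_Icc'[OF this, of x] show ?thesis
    using assms by simp
qed

lemma osc_reflect: "q > 0 \<Longrightarrow> osc q (int q - k) = osc q k"
  using osc_cong_mod[of q "int q - k" "- k"] by simp

text \<open>By reflection the residue is at most q/2. At 1 the bound is asymptotically sharp, and
  the factor 1 - 4/(3q) pays for the quartic Taylor term. From 2 on, Jordan's inequality gives 8 l^2
  / q^2, which already beats pi^2 (1 + l) / q^2.\<close>

lemma osc_ge_linear:
  assumes q: "q \<ge> 3" and k: "0 < k" "k < int q"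
  shows "pi ^ 2 / real q ^ 2 * (1 - 4 / (3 * real q)) * (1 + real_of_int (min k (int q - k))) \<le> osc q k"
proof -
  have main: "pi ^ 2 / real q ^ 2 * (1 - 4 / (3 * real q)) * (1 + real_of_int l) \<le> osc q l" if l: "0 < l" "2 * l \<le> int q" for l
  proof (cases "l = 1")
    case True
    have "pi ^ 2 \<le> (16 / 5) ^ 2"
      using pi_less_16_5 by (intro power_mono) auto
    then have "pi ^ 2 \<le> 4 * real q"
      using q by (simp add: power_divide)
    then have "2 * pi ^ 2 / real q ^ 2 * (pi ^ 2 / (3 * real q ^ 2)) \<le> 2 * pi ^ 2 / real q ^ 2 * (4 * real q / (3 * real q ^ 2))"
      by (intro mult_left_mono divide_right_mono) auto
    moreover have inv_q: "4 * real q / (3 * real q ^ 2) = 4 / (3 * real q)"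
      by (simp add: power2_eq_square)
    ultimately have "2 * pi ^ 2 / real q ^ 2 * (pi ^ 2 / (3 * real q ^ 2)) \<le> 2 * pi ^ 2 / real q ^ 2 * (4 / (3 * real q))"
      by (simp only: inv_q)
    moreover have "cos (2 * pi / real q) \<le> 1 - 2 * pi ^ 2 / real q ^ 2 + 2 * pi ^ 2 / real q ^ 2 * (pi ^ 2 / (3 * real q ^ 2))"
      using cos_le_quartic[of "2 * pi / real q"] by (simp add: power_divide power_mult_distrib power4_eq_xxxx power2_eq_square mult_ac)
    moreover have "pi ^ 2 / real q ^ 2 * (1 - 4 / (3 * real q)) * (1 + real_of_int l)
        = 2 * pi ^ 2 / real q ^ 2 - 2 * pi ^ 2 / real q ^ 2 * (4 / (3 * real q))"
      by (simp add: True right_diff_distrib left_diff_distrib)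
    moreover have "osc q l = 1 - cos (2 * pi / real q)"
      by (simp add: True osc_def)
    ultimately show ?thesis by linarith
  next
    case False
    then have l2: "2 \<le> real_of_int l" using l by simp
    have "2 * (pi * real_of_int l / real q) / pi \<le> sin (pi * real_of_int l / real q)"
    proof (rule jordan_sin)
      have "real_of_int (2 * l) \<le> real_of_int (int q)"
        using l(2) by (rule of_int_le_iff[THEN iffD2])
      then show "pi * real_of_int l / real q \<le> pi / 2"
        using q by (simp add: field_simps)
    qed (use l in auto)
    then have "2 * (2 * real_of_int l / real q) ^ 2 \<le> osc q l"
      unfolding osc_eq_sin using l by (intro mult_left_mono power_mono) auto
    moreover have "pi ^ 2 / real q ^ 2 * (1 - 4 / (3 * real q)) * (1 + real_of_int l) \<le> 2 * (2 * real_of_int l / real q) ^ 2"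
    proof -
      have "pi ^ 2 \<le> (16 / 5) ^ 2"
        using pi_less_16_5 by (intro power_mono) auto
      then have "pi ^ 2 * (1 + real_of_int l) \<le> 32 / 3 * (1 + real_of_int l)"
        using l by (intro mult_right_mono) (auto simp: power_divide)
      also have "\<dots> \<le> 8 * real_of_int l ^ 2"
      proof -
        \<comment> \<open>The quadratic vanishes at l = 2: the constant 32/3 is the largest bound on
          pi^2 that this case tolerates.\<close>
        have "0 \<le> (real_of_int l - 2) * (24 * real_of_int l + 16)"
          using l2 by (intro mult_nonneg_nonneg) auto
        then show ?thesis by (simp add: power2_eq_square algebra_simps)
      qed
      finally have "pi ^ 2 * (1 + real_of_int l) / real q ^ 2 \<le> 8 * real_of_int l ^ 2 / real q ^ 2"
        by (rule divide_right_mono) simp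
      moreover have "(1 - 4 / (3 * real q)) * (pi ^ 2 * (1 + real_of_int l) / real q ^ 2) \<le> 1 * (pi ^ 2 * (1 + real_of_int l) / real q ^ 2)"
        using l by (intro mult_right_mono) auto
      ultimately show ?thesis
        by (simp add: power_divide power_mult_distrib mult_ac)
    qed
    ultimately show ?thesis by linarith
  qed
  show ?thesis
  proof (cases "2 * k \<le> int q")
    case True
    then show ?thesis using main[of k] k by (simp add: min_def)
  next
    case False
    then show ?thesis using main[of "int q - k"] k osc_reflect[of q k] q by (simp add: min_def)
  qed
qed

section \<open>The choice of the time and the limit of large n\<close>

lemma dg_d_le_explicit:
  fixes N :: real
  assumes ne: "tables n q r c \<noteq> {}" and n: "n \<ge> 2" and q: "q \<ge> 3" and N: "N \<ge> 16"
    and root: "N powr (1/2) * ln N \<le> real n * ln 2"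
    and dense: "(64 * N powr (- 1/2)) powr (real n / 4) \<le> real n * N powr (- 2)" "4 * N powr (- 1/2) \<le> 1"
    and nN: "49 * real n / N \<le> 1" "588 * real n ^ 2 / N ^ 2 \<le> 1"
  shows "dg_d n q r c (real n ^ 2 * real q ^ 2 * ln N / (8 * pi ^ 2) * inverse (1 - 4 / (3 * real q)))
    \<le> 1/2 * sqrt (588 * real n ^ 2 / N ^ 2 + (784 * real n / N) powr (real n / 4))"
proof -
  define g where "g = 1 - 4 / (3 * real q)"
  define t where "t = real n ^ 2 * real q ^ 2 * ln N / (8 * pi ^ 2) * inverse g"
  \<comment> \<open>Chosen so that the two-level energy of \<open>\<xi>\<close> is exactly 2 t times
    its gap, the exponent in the l2 bound.\<close>
  define \<kappa> where "\<kappa> = 8 * t / (real n - 1) ^ 2"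
  have q0: "q > 0" and n0: "n > 0" using q n by auto
  have g: "g > 0" using q by (simp add: g_def field_simps)
  have lnN: "ln N \<ge> 0" using N by simp
  have \<kappa>0: "\<kappa> \<ge> 0"
    using g lnN by (simp add: \<kappa>_def t_def)
  have energy: "- osc_energy n q \<kappa> \<xi> = - 2 * t * gap n q \<xi>" for \<xi>
    using n by (simp add: osc_energy_eq_gap[OF q0 n] \<kappa>_def)
  have osc: "ln N * (1 + real_of_int (min k (int q - k))) \<le> \<kappa> * osc q k" if k: "0 < k" "k < int q" for k
  proof -
    let ?u = "1 + real_of_int (min k (int q - k))"
    have u: "?u \<ge> 0" using k by simp
    have "ln N * ?u * 1 \<le> ln N * ?u * (real n ^ 2 / (real n - 1) ^ 2)"
      using n lnN u by (intro mult_left_mono mult_nonneg_nonneg) (auto simp: field_simps intro!: power_mono)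
    also have "\<dots> = \<kappa> * (pi ^ 2 / real q ^ 2 * g * ?u)"
      using g q0 n by (simp add: \<kappa>_def t_def field_simps)
    also have "\<dots> \<le> \<kappa> * osc q k"
      using osc_ge_linear[OF q k] \<kappa>0 by (intro mult_left_mono) (simp_all add: g_def)
    finally show ?thesis by simp
  qed
  \<comment> \<open>Either N^(2m/n) <= 2, which is enough because m >= 1, or \<open>root\<close>
    forces 2m > sqrt N, and then m <= n/4 bounds the left-hand side by sqrt N.\<close>
  have H: "N powr (2 * real m / real n) \<le> 2 * real m" if m: "m \<in> {1..n div 4}" for m
  proof (cases "2 * real m / real n * ln N \<le> ln 2")
    case True
    then have "exp (2 * real m / real n * ln N) \<le> exp (ln 2)" by (simp only: exp_le_cancel_iff)
    then show ?thesis using N m by (simp add: powr_def)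
  next
    case False
    then have "real n * ln 2 < 2 * real m * ln N"
      using n0 by (simp add: field_simps)
    then have "N powr (1/2) * ln N < 2 * real m * ln N" using root by linarith
    then have "N powr (1/2) < 2 * real m" using lnN by (simp add: mult_less_cancel_right)
    moreover have "N powr (2 * real m / real n) \<le> N powr (1/2)"
      using N m n0 by (intro powr_mono) (auto simp: field_simps)
    ultimately show ?thesis by linarith
  qed
  have "dg_d n q r c t \<le> 1/2 * sqrt (\<Sum>\<xi>\<in>duals n q - {dual0 n}. exp (- 2 * t * gap n q \<xi>))"
    by (rule dg_d_le[OF ne q0 n])
  also have "\<dots> = 1/2 * sqrt (\<Sum>\<xi>\<in>duals n q - {dual0 n}. exp (- osc_energy n q \<kappa> \<xi>))"
    by (simp only: energy)
  also have "\<dots> \<le> 1/2 * sqrt (588 * real n ^ 2 / N ^ 2 + (784 * real n / N) powr (real n / 4))"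
    by (intro mult_left_mono real_sqrt_le_mono sum_exp_osc_energy_le n0 q0 N \<kappa>0 osc H dense nN) auto
  finally show ?thesis
    by (simp only: t_def g_def)
qed

text \<open>The last summand of the constant suffices: 32/e >= 32/3 >= 10 and e >= 2 give 6 * 2^10 =
  6144. The inequality exp u - 1 >= u then forces the fourth root of every admissible z to be at
  least 6144 / (4 \<epsilon>^2).\<close>

lemma alpha_const_ge:
  assumes "0 < \<epsilon>" "\<epsilon> < 1"
  shows "alpha_const \<epsilon> \<ge> (6144 / (4 * \<epsilon> ^ 2)) ^ 4"
proof -
  define C :: real where "C = 6 + 12 * exp (4 / exp 1) + 12 * exp (8 / exp 1) + 6 * exp (32 / exp 1)"
  have C: "C \<ge> 6144"
  proof -
    have "(2::real) ^ 10 \<le> exp 1 ^ 10"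
      using exp_ge_add_one_self[of 1] by (intro power_mono) auto
    also have "\<dots> = exp (10::real)"
      using exp_of_nat_mult[of 10 "1::real"] by simp
    also have "\<dots> \<le> exp (32 / exp 1)"
    proof -
      have "(10::real) \<le> 32 / 3" by simp
      also have "\<dots> \<le> 32 / exp 1"
        using exp_le by (intro divide_left_mono) auto
      finally show ?thesis by simp
    qed
    finally have "exp (32 / exp 1 :: real) \<ge> 1024" by simp
    moreover have "exp (4 / exp 1 :: real) > 0" "exp (8 / exp 1 :: real) > 0" by simp_all
    ultimately show ?thesis unfolding C_def by linarith
  qed
  define Z where "Z = {z. z \<ge> 1 \<and> 4 * \<epsilon> ^ 2 \<ge> exp (C / z powr (1/4)) - 1}"
  \<comment> \<open>Some z must be admissible before a lower bound on all of them passes to the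
    infimum.\<close>
  have "((\<lambda>z. exp (C / z powr (1/4)) - 1) \<longlongrightarrow> 0) at_top"
    by real_asymp
  then have "\<forall>\<^sub>F z in at_top. exp (C / z powr (1/4)) - 1 < 4 * \<epsilon> ^ 2"
    by (rule order_tendstoD) (use assms in simp)
  then have "\<forall>\<^sub>F z in at_top. z \<ge> 1 \<and> exp (C / z powr (1/4)) - 1 < 4 * \<epsilon> ^ 2"
    by (intro eventually_conj eventually_ge_at_top)
  then have "\<exists>z. z \<ge> 1 \<and> exp (C / z powr (1/4)) - 1 < 4 * \<epsilon> ^ 2"
    using eventually_happens' trivial_limit_at_top_linorder by blast
  then have "Z \<noteq> {}"
    by (auto simp: Z_def intro: less_imp_le)
  moreover have "(6144 / (4 * \<epsilon> ^ 2)) ^ 4 \<le> z" if "z \<in> Z" for z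
  proof -
    have z: "z \<ge> 1" "exp (C / z powr (1/4)) - 1 \<le> 4 * \<epsilon> ^ 2"
      using that by (auto simp: Z_def)
    have "C / z powr (1/4) \<le> 4 * \<epsilon> ^ 2"
      using z(2) exp_ge_add_one_self[of "C / z powr (1/4)"] by linarith
    then have "C / (4 * \<epsilon> ^ 2) \<le> z powr (1/4)"
      using z(1) assms by (simp add: field_simps)
    moreover have "6144 / (4 * \<epsilon> ^ 2) \<le> C / (4 * \<epsilon> ^ 2)"
      using C by (intro divide_right_mono) auto
    ultimately have "(6144 / (4 * \<epsilon> ^ 2)) ^ 4 \<le> (z powr (1/4)) ^ 4"
      by (intro power_mono) auto
    also have "\<dots> = (z powr (1/4)) powr 4"
      using z(1) powr_realpow[of "z powr (1/4)" 4] by simp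
    also have "\<dots> = z"
      unfolding powr_powr using z(1) by simp
    finally show ?thesis .
  qed
  ultimately have "(6144 / (4 * \<epsilon> ^ 2)) ^ 4 \<le> Inf Z"
    by (rule cInf_greatest)
  then show ?thesis
    by (simp only: alpha_const_def Z_def C_def)
qed

text \<open>Since n / (n - 1) <= 2, the sparse term 588 n^2 / N^2 is at most 2352 / \<alpha>, hence
  at most 4 \<epsilon>^2. Half of its root is at most \<epsilon>, and subadditivity of the root
  leaves the dense term as the vanishing error.\<close>

lemma eventually_dg_d_le_eps:
  fixes q :: "nat \<Rightarrow> nat" and r c :: "nat \<Rightarrow> nat \<Rightarrow> int"
  assumes eps: "0 < \<epsilon>" "\<epsilon> < 1" and \<delta>: "\<delta> > 0"
    and nonempty: "\<forall>\<^sub>F n in sequentially. tables n (q n) (r n) (c n) \<noteq> {}"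
    and q: "\<forall>\<^sub>F n in sequentially. q n \<ge> 3"
  shows "\<forall>\<^sub>F n in sequentially. dg_d n (q n) (r n) (c n)
      (real n ^ 2 * real (q n) ^ 2 * ln (sqrt (alpha_const \<epsilon>) * (real n - 1)) / (8 * pi ^ 2)
       * inverse (1 - 4 / (3 * real (q n)))) \<le> \<epsilon> + \<delta>"
proof -
  define \<alpha> where "\<alpha> = alpha_const \<epsilon>"
  define a where "a = sqrt \<alpha>"
  have B: "6144 / (4 * \<epsilon> ^ 2) \<ge> 1536"
    using eps power_le_one[of \<epsilon> 2] by (simp add: field_simps)
  have \<alpha>_ge: "\<alpha> \<ge> (6144 / (4 * \<epsilon> ^ 2)) ^ 4"
    unfolding \<alpha>_def by (rule alpha_const_ge[OF eps])
  have "(1536 ^ 2) ^ 2 \<le> (6144 / (4 * \<epsilon> ^ 2)) ^ 4"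
    using power_mono[OF B, of 4] by simp
  then have "(1536 ^ 2) ^ 2 \<le> \<alpha>" using \<alpha>_ge by linarith
  then have a: "a \<ge> 1536 ^ 2"
    unfolding a_def by (rule real_le_rsqrt)
  have a2: "a ^ 2 = \<alpha>"
    using \<open>(1536 ^ 2) ^ 2 \<le> \<alpha>\<close> by (simp add: a_def)
  have \<alpha>_eps: "2352 / a ^ 2 \<le> 4 * \<epsilon> ^ 2"
  proof -
    \<comment> \<open>The base exceeds 1, so one of its four powers already suffices, and 2352 <=
      6144.\<close>
    have "6144 / (4 * \<epsilon> ^ 2) \<le> (6144 / (4 * \<epsilon> ^ 2)) ^ 4"
      using B by (intro self_le_power) auto
    then have "6144 / (4 * \<epsilon> ^ 2) \<le> a ^ 2" using \<alpha>_ge a2 by linarith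
    then show ?thesis using eps a by (simp add: field_simps)
  qed
  have a0: "a > 0" using a by simp
  define N where "N n = a * (real n - 1)" for n :: nat
  have "\<forall>\<^sub>F n in sequentially. N n powr (1/2) * ln (N n) \<le> real n * ln 2"
    unfolding N_def using a0 by real_asymp
  moreover have "\<forall>\<^sub>F n in sequentially. (64 * N n powr (- 1/2)) powr (real n / 4) \<le> real n * N n powr (- 2)"
    unfolding N_def using a0 by real_asymp
  moreover have "\<forall>\<^sub>F n in sequentially. 4 * N n powr (- 1/2) \<le> 1"
    unfolding N_def using a0 by real_asymp
  moreover have "\<forall>\<^sub>F n in sequentially. N n \<ge> 16"
    unfolding N_def using a0 by real_asymp
  moreover have "\<forall>\<^sub>F n in sequentially. 1/2 * sqrt ((1/2) powr (real n / 4)) \<le> \<delta>"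
    using \<delta> by real_asymp
  ultimately show ?thesis
    using nonempty q eventually_ge_at_top[of 2]
  proof eventually_elim
    case (elim n)
    have n: "n \<ge> 2" by fact
    have Npos: "N n > 0" using elim(4) by simp
    have n_N: "real n / N n \<le> 2 / a"
      using n a0 by (simp add: N_def field_simps)
    have n_N2: "real n ^ 2 / N n ^ 2 \<le> 4 / a ^ 2"
      using power_mono[OF n_N, of 2] Npos by (simp add: power_divide)
    have small: "2 / a \<le> 2 / 1536 ^ 2"
      using a by (intro divide_left_mono) auto
    have sparse: "588 * real n ^ 2 / N n ^ 2 \<le> 4 * \<epsilon> ^ 2"
      using n_N2 \<alpha>_eps by simp
    have "dg_d n (q n) (r n) (c n) (real n ^ 2 * real (q n) ^ 2 * ln (N n) / (8 * pi ^ 2) * inverse (1 - 4 / (3 * real (q n))))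
      \<le> 1/2 * sqrt (588 * real n ^ 2 / N n ^ 2 + (784 * real n / N n) powr (real n / 4))"
    proof (rule dg_d_le_explicit)
      show "49 * real n / N n \<le> 1"
        using n_N small by simp
      have "(2 / a) ^ 2 \<le> (2 / 1536 ^ 2) ^ 2"
        using small a0 by (intro power_mono) auto
      then show "588 * real n ^ 2 / N n ^ 2 \<le> 1"
        using n_N2 by (simp add: power_divide)
    qed (use elim in auto)
    also have "\<dots> \<le> 1/2 * sqrt ((2 * \<epsilon>) ^ 2 + (1/2) powr (real n / 4))"
    proof (intro mult_left_mono real_sqrt_le_mono add_mono powr_mono2)
      show "784 * real n / N n \<le> 1/2"
        using n_N small by simp
    qed (use sparse Npos in \<open>auto simp: power_mult_distrib\<close>)
    also have "\<dots> \<le> 1/2 * (sqrt ((2 * \<epsilon>) ^ 2) + sqrt ((1/2) powr (real n / 4)))"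
      by (intro mult_left_mono sqrt_add_le_add_sqrt) auto
    also have "\<dots> = \<epsilon> + 1/2 * sqrt ((1/2) powr (real n / 4))"
    proof -
      have "sqrt ((2 * \<epsilon>) ^ 2) = 2 * \<epsilon>"
        by (rule real_sqrt_unique) (use eps in auto)
      then show ?thesis by (simp only: distrib_left)
    qed
    also have "\<dots> \<le> \<epsilon> + \<delta>"
      using elim(5) by simp
    finally show ?case
      by (simp only: N_def a_def \<alpha>_def)
  qed
qed

theorem theorem2:
  fixes \<epsilon> :: real and q :: "nat \<Rightarrow> nat"
    and r c :: "nat \<Rightarrow> nat \<Rightarrow> int"
  assumes eps: "0 < \<epsilon>" "\<epsilon> < 1"
    and qpos: "\<And>n. q n > 0"
    and nonempty: "\<forall>\<^sub>F n in sequentially. tables n (q n) (r n) (c n) \<noteq> {}"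
  shows
    "(filterlim (\<lambda>n. real (q n) / real n ^ 2) at_top sequentially \<longrightarrow>
       (\<forall>\<delta>>0. \<forall>\<^sub>F n in sequentially.
          dg_d n (q n) (r n) (c n)
            (real n ^ 2 * real (q n) ^ 2 * ln (sqrt (alpha_const \<epsilon>) * (real n - 1)) / (8 * pi ^ 2)
             * inverse (1 - 4 / (3 * real (q n))))
          \<le> \<epsilon> + \<delta>))
     \<and>
     (filterlim q at_top sequentially \<and>
      filterlim (\<lambda>n. real (q n) / sqrt (ln (real n))) at_top sequentially \<longrightarrow>
       (\<forall>\<^sub>F n in sequentially.
          dg_tmix n (q n) (r n) (c n) \<epsilon> \<ge>
            real n ^ 2 * real (q n) ^ 2 / (8 * pi ^ 2) *
            (ln (real n) + ln (1 - 1 / real n) + 1/2 * ln ((inverse \<epsilon> - 1) / 5))))"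
proof (intro conjI impI allI)
  fix \<delta> :: real
  assume "filterlim (\<lambda>n. real (q n) / real n ^ 2) at_top sequentially" and \<delta>: "\<delta> > 0"
  then have "\<forall>\<^sub>F n in sequentially. 3 \<le> real (q n) / real n ^ 2"
    by (simp add: filterlim_at_top)
  then have "\<forall>\<^sub>F n in sequentially. q n \<ge> 3"
    using eventually_gt_at_top[of 0]
  proof eventually_elim
    case (elim n)
    have "3 * 1 \<le> 3 * real n ^ 2"
      using elim(2) by (intro mult_left_mono one_le_power) auto
    also have "\<dots> \<le> real (q n)"
      using elim by (simp add: field_simps)
    finally show ?case by simp
  qed
  then show "\<forall>\<^sub>F n in sequentially. dg_d n (q n) (r n) (c n)
      (real n ^ 2 * real (q n) ^ 2 * ln (sqrt (alpha_const \<epsilon>) * (real n - 1)) / (8 * pi ^ 2)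
       * inverse (1 - 4 / (3 * real (q n)))) \<le> \<epsilon> + \<delta>"
    by (rule eventually_dg_d_le_eps[OF eps \<delta> nonempty])
qed (use dg_tmix_ge[OF eps nonempty] in auto)

end
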